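(* Let $\pi$ be the adaptive policy for the robust CDS problem in the full feedback model given by the algorithm described below, run with an $\alpha$-approximation algorithm for the node-weighted polymatroid Steiner tree problem as subroutine. Then $\pi$ achieves the approximation factor $2\alpha(1+\lg(1/\delta))$, i.e., $w_{\rm avg}(\pi)\le 2\alpha(1+\lg(1/\delta))\,w_{\rm avg}(\pi')$ for every adaptive policy $\pi'$ in the full feedback model.
   Context: Robust CDS problem. Let $G=(V,E)$ be a connected undirected graph, $w\colon V\to\mathbb{R}_+$ node weights and $r\in V$ a root. $N[v]$ is $v$ with its neighbors, $N[X]=\bigcup_{v\in X}N[v]$, and $X$ dominates $v$ if $v\in N[X]$; $G[X]$ is the induced subgraph. A full realization is $\psi\in\{0,1\}^V$ with $\psi(r)=1$ ($\psi(v)=1$: $v$ active); $\Psi$ is the set of full realizations, $p$ a probability distribution on $\Psi$ (with rational values), $A_\psi=\{v:\psi(v)=1\}$; $u\sim_\psi v$ means $u,v$ are active and in the same component of $G[A_\psi]$. The task, for the unknown $\psi$, is to find a set of active nodes containing $r$, inducing a connected subgraph, and dominating every node of the component of $G[A_\psi]$ containing $r$. A realization is $\phi\in\{0,1,*\}^V$, ${\rm supp}(\phi)=\{v:\phi(v)\ne*\}$; $\psi\succeq\phi$ means they agree on ${\rm supp}(\phi)$; $p(\phi)=\sum_{\psi\succeq\phi}p(\psi)$ and $p(\psi\mid\phi)=p(\psi)/p(\phi)$. An adaptive policy knows $G,w,r,\Psi,p$ but not $\psi$; starting from the chosen set $\{r\}$ (in the full feedback model the states of the neighbors of $r$ are known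 initially), it repeatedly chooses a node dominated by the chosen active nodes and receives feedback depending on observations so far; in the full feedback model, choosing an active $v$ reveals the states of $v$ and all its neighbors (only $v$'s state if $v$ is inactive). It stops once the observations determine that the chosen active nodes form a solution. $U(\pi,\psi)$ is the set of nodes chosen by $\pi$ under $\psi$, $w(\pi,\psi)=\sum_{v\in U(\pi,\psi)}w(v)$, $w_{\rm avg}(\pi)=\sum_{\psi}p(\psi)w(\pi,\psi)$. Let $\delta=\min\{p(\psi):p(\psi)>0\}$, $M$ the least positive number with $Mp(\psi)\in\mathbb{Z}_+$ for all $\psi$, and $\lg=\log_2$. Node-weighted polymatroid Steiner tree problem: given a graph, node weights, a root and a polymatroid $f$ (monotone, submodular, $f(\emptyset)=0$, integer-valued) on its node set, find a minimum node-weight tree containing the root whose node set $U$ has $f(U)$ equal to $f$ of the whole node set. The algorithm. Initially $U=\{r\}$, $\phi(r)=1$, $\phi(v)=1$ for active neighbors $v$ of $r$, inactive neighbors of $r$ are removed from $G$, and $\phi(v)=*$ otherwise. While $U$ does not dominate all nodes of the current graph, perform a round: let $\Psi_\phi=\{\psi\succeq\phi:p(\psi)>0\}$, $H=\{v\in V\setminus U:\sum_{\psi\in\Psi_\phi:v\in A_\psi}p(\psi\mid\phi)>1/2\}$, $R$ the node set of the component of $G[U\cup H]$ containing $r$. For $v\in R\cap H$ let $\xi_v(u)=*$ if $u\notin N[v]$, $1$ if $u\in H\cap N[v]$, $0$ if $u\in N[v]\setminus H$; for $H'\subseteq R\cap H$ let $\Psi_{H'}=\{\psi\in\Psi_\phi:\psi\succeq\xi_v\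 \forall v\in H'\}$. For $X\subseteq R$ let $f_{\rm plt}(X)=|(V\setminus{\rm supp}(\phi))\cap N[X]|+\sum_{v\in(V\setminus{\rm supp}(\phi))\setminus N[X]}(1-\sum_{\psi\in\Psi_{X\cap H}:v\sim_\psi r}p(\psi))$ and $f_{\rm plr}(X)=\min\{1/2,\,1-\sum_{\psi\in\Psi_{X\cap H}}p(\psi\mid\phi)\}$. Use weights $w'(v)=0$ for $v\in U$ and $w'(v)=w(v)$ for $v\in H\setminus U$. Solve (with the $\alpha$-approximation algorithm) the node-weighted polymatroid Steiner tree instance on $G[R]$ with root $r$, weights $w'$ and polymatroid $M(f_{\rm plt}(X)-f_{\rm plt}(\emptyset))$, and let $H_{\rm plt}$ be the set of nodes of $H$ spanned by the computed tree. If $f_{\rm plr}(R)<1/2$ set $H_{\rm plr}=H$; otherwise solve the instance on $G[R]$, root $r$, weights $w'$, polymatroid $2Mp(\phi)f_{\rm plr}$, and let $H_{\rm plr}$ be the nodes of $H$ spanned by the tree. Let $H^*$ be the one of $H_{\rm plt},H_{\rm plr}$ of smaller weight $w$. While $H^*\not\subseteq U$: choose $v\in(H^*\setminus U)\cap N[U]$, add it to $U$, set $\phi(u)$ to the observed state for each $u\in N[v]\setminus{\rm supp}(\phi)$, and if $\phi(u)\ne\xi_v(u)$ for some $u\in N[v]$, end the round. At the end of the round, remove from $G$ every node $u$ with $\psi(u)=0$ for all $\psi\in\Psi_\phi$, and then all connected components not containing $r$. Finally output $U$.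
   Formalization: The algorithm is corrected in two places, since the bound fails as written: ξ_v(u)=1 also for already chosen u∈U∩N[v] (not 0), and the initial φ records 0 (not * ) for inactive neighbors of r. If the weights of H_plt and H_plr tie, H_plt is taken. *)

theory Defs
  imports "HOL-Probability.Probability_Mass_Function"
begin

section \<open>Graphs\<close>

definition ugraph :: "'v set \<Rightarrow> 'v rel \<Rightarrow> bool" where
  "ugraph V E \<longleftrightarrow> finite V \<and> E \<subseteq> V \<times> V \<and> sym E \<and> irrefl E"

definition induced :: "'v rel \<Rightarrow> 'v set \<Rightarrow> 'v rel" where
  "induced E X = E \<inter> (X \<times> X)"

definition connected_graph :: "'v set \<Rightarrow> 'v rel \<Rightarrow> bool" where
  "connected_graph V E \<longleftrightarrow> (\<forall>u\<in>V. \<forall>v\<in>V. (u, v) \<in> E\<^sup>*)"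

definition component :: "'v rel \<Rightarrow> 'v \<Rightarrow> 'v set" where
  "component E v = E\<^sup>* `` {v}"

definition nbh :: "'v rel \<Rightarrow> 'v \<Rightarrow> 'v set" where
  "nbh E v = insert v (E `` {v})"

definition nbhs :: "'v rel \<Rightarrow> 'v set \<Rightarrow> 'v set" where
  "nbhs E X = (\<Union>v\<in>X. nbh E v)"

definition cycle :: "'v rel \<Rightarrow> 'v list \<Rightarrow> bool" where
  "cycle E c \<longleftrightarrow> length c \<ge> 3 \<and> distinct c \<and>
     (\<forall>i<length c. (c ! i, c ! (Suc i mod length c)) \<in> E)"

definition is_tree :: "'v set \<Rightarrow> 'v rel \<Rightarrow> bool" where
  "is_tree T F \<longleftrightarrow> T \<noteq> {} \<and> ugraph T F \<and> connected_graph T F \<and> (\<nexists>c. cycle F c)"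


section \<open>The node-weighted polymatroid Steiner tree problem\<close>

definition polymatroid :: "'v set \<Rightarrow> ('v set \<Rightarrow> real) \<Rightarrow> bool" where
  "polymatroid V f \<longleftrightarrow>
     f {} = 0 \<and>
     (\<forall>X\<subseteq>V. f X \<in> \<int>) \<and>
     (\<forall>X Y. X \<subseteq> Y \<and> Y \<subseteq> V \<longrightarrow> f X \<le> f Y) \<and>
     (\<forall>X Y. X \<subseteq> V \<and> Y \<subseteq> V \<longrightarrow> f (X \<union> Y) + f (X \<inter> Y) \<le> f X + f Y)"

definition steiner_feasible ::
  "'v set \<Rightarrow> 'v rel \<Rightarrow> 'v \<Rightarrow> ('v set \<Rightarrow> real) \<Rightarrow> 'v set \<times> 'v rel \<Rightarrow> bool" where
  "steiner_feasible V E r f T \<longleftrightarrow>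
     is_tree (fst T) (snd T) \<and> fst T \<subseteq> V \<and> snd T \<subseteq> E \<and> r \<in> fst T \<and> f (fst T) = f V"

type_synonym 'v steiner_alg =
  "'v set \<Rightarrow> 'v rel \<Rightarrow> 'v \<Rightarrow> ('v \<Rightarrow> real) \<Rightarrow> ('v set \<Rightarrow> real) \<Rightarrow> 'v set \<times> 'v rel"

definition steiner_approx :: "real \<Rightarrow> 'v steiner_alg \<Rightarrow> bool" where
  "steiner_approx \<alpha> S \<longleftrightarrow>
     (\<forall>V E r w f.
        ugraph V E \<and> r \<in> V \<and> (\<forall>v\<in>V. 0 \<le> w v) \<and> polymatroid V f \<and>
        (\<exists>T. steiner_feasible V E r f T) \<longrightarrow>
          steiner_feasible V E r f (S V E r w f) \<and>
          (\<forall>T. steiner_feasible V E r f T \<longrightarrow>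
             sum w (fst (S V E r w f)) \<le> \<alpha> * sum w (fst T)))"


section \<open>The robust CDS problem\<close>

text \<open>The node set of the graph is the (finite) type of nodes.  Full realizations are
  Boolean functions, realizations are partial ones, with \<^term>\<open>None\<close> in the role of the
  unknown state and \<^term>\<open>dom\<close> in the role of the support.\<close>

type_synonym 'v full = "'v \<Rightarrow> bool"

type_synonym 'v realization = "'v \<Rightarrow> bool option"

record 'v rcds =
  edges :: "'v rel"
  weight :: "'v \<Rightarrow> real"
  root :: 'v
  dist :: "'v full pmf"

definition full_realizations :: "'v rcds \<Rightarrow> 'v full set" where
  "full_realizations I = {\<psi>. \<psi> (root I)}"

definition robust_cds :: "('v::finite) rcds \<Rightarrow> bool" where
  "robust_cds I \<longleftrightarrow>
     ugraph UNIV (edges I) \<and> connected_graph UNIV (edges I) \<and>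
     (\<forall>v. 0 \<le> weight I v) \<and>
     set_pmf (dist I) \<subseteq> full_realizations I \<and>
     (\<forall>\<psi>. pmf (dist I) \<psi> \<in> \<rat>)"

definition extends :: "'v full \<Rightarrow> 'v realization \<Rightarrow> bool" where
  "extends \<psi> \<phi> \<longleftrightarrow> (\<forall>v\<in>dom \<phi>. \<phi> v = Some (\<psi> v))"

definition active :: "'v full \<Rightarrow> 'v set" where
  "active \<psi> = {v. \<psi> v}"

definition same_comp :: "'v rcds \<Rightarrow> 'v full \<Rightarrow> 'v \<Rightarrow> 'v \<Rightarrow> bool" where
  "same_comp I \<psi> u v \<longleftrightarrow>
     u \<in> active \<psi> \<and> v \<in> active \<psi> \<and> v \<in> component (induced (edges I) (active \<psi>)) u"

definition prob_of :: "'v rcds \<Rightarrow> 'v realization \<Rightarrow> real" where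
  "prob_of I \<phi> = (\<Sum>\<psi> | \<psi> \<in> full_realizations I \<and> extends \<psi> \<phi>. pmf (dist I) \<psi>)"

definition cond_prob :: "'v rcds \<Rightarrow> 'v realization \<Rightarrow> 'v full \<Rightarrow> real" where
  "cond_prob I \<phi> \<psi> = pmf (dist I) \<psi> / prob_of I \<phi>"

definition Psi :: "'v rcds \<Rightarrow> 'v realization \<Rightarrow> 'v full set" where
  "Psi I \<phi> = {\<psi> \<in> full_realizations I. extends \<psi> \<phi> \<and> pmf (dist I) \<psi> > 0}"

definition solution :: "'v rcds \<Rightarrow> 'v full \<Rightarrow> 'v set \<Rightarrow> bool" where
  "solution I \<psi> X \<longleftrightarrow>
     X \<subseteq> active \<psi> \<and> root I \<in> X \<and> connected_graph X (induced (edges I) X) \<and>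
     component (induced (edges I) (active \<psi>)) (root I) \<subseteq> nbhs (edges I) X"

definition delta :: "'v rcds \<Rightarrow> real" where
  "delta I = Min {pmf (dist I) \<psi> |\<psi>. pmf (dist I) \<psi> > 0}"

definition multiplier :: "'v rcds \<Rightarrow> real" where
  "multiplier I = (LEAST m. m > 0 \<and> (\<forall>\<psi>\<in>full_realizations I. m * pmf (dist I) \<psi> \<in> \<nat>))"


section \<open>Adaptive policies in the full feedback model\<close>

text \<open>All that has been observed under \<open>\<psi>\<close> once the nodes of \<open>U\<close> have been chosen.\<close>

definition observed :: "'v rcds \<Rightarrow> 'v full \<Rightarrow> 'v set \<Rightarrow> 'v realization" where
  "observed I \<psi> U =
     (\<lambda>u. if u \<in> U \<union> nbhs (edges I) (U \<inter> active \<psi>) then Some (\<psi> u) else None)"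

text \<open>A policy is a decision tree: the next choice depends on the position in the tree and on
  the observations made so far.  The first decision already sees the states of the
  neighbors of the root, so that a policy maps the initial observations to a tree.\<close>

datatype 'v dtree = Stop | Choose 'v "'v realization \<Rightarrow> 'v dtree"

type_synonym 'v policy = "'v realization \<Rightarrow> 'v dtree"

primrec play :: "'v rcds \<Rightarrow> 'v full \<Rightarrow> 'v dtree \<Rightarrow> 'v list \<Rightarrow> 'v list" where
  "play I \<psi> Stop us = us"
| "play I \<psi> (Choose v k) us = play I \<psi> (k (observed I \<psi> (set (us @ [v])))) (us @ [v])"

text \<open>The nodes chosen under \<open>\<psi>\<close>, in the order of their choice.\<close>

definition run :: "'v rcds \<Rightarrow> 'v policy \<Rightarrow> 'v full \<Rightarrow> 'v list" where
  "run I \<pi> \<psi> = play I \<psi> (\<pi> (observed I \<psi> {root I})) [root I]"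

definition determined :: "'v rcds \<Rightarrow> 'v realization \<Rightarrow> 'v set \<Rightarrow> bool" where
  "determined I \<phi> U \<longleftrightarrow> (\<forall>\<psi>\<in>Psi I \<phi>. solution I \<psi> {v\<in>U. \<phi> v = Some True})"

text \<open>A policy may only stop when the observations determine that it has a solution.  It is
  allowed, at its own expense, to choose further nodes after that point.\<close>

primrec legal :: "'v rcds \<Rightarrow> 'v full \<Rightarrow> 'v dtree \<Rightarrow> 'v list \<Rightarrow> bool" where
  "legal I \<psi> Stop us \<longleftrightarrow> determined I (observed I \<psi> (set us)) (set us)"
| "legal I \<psi> (Choose v k) us \<longleftrightarrow>
     v \<in> nbhs (edges I) (set us \<inter> active \<psi>) \<and>
     legal I \<psi> (k (observed I \<psi> (set (us @ [v])))) (us @ [v])"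

definition adaptive_policy :: "'v rcds \<Rightarrow> 'v policy \<Rightarrow> bool" where
  "adaptive_policy I \<pi> \<longleftrightarrow>
     (\<forall>\<psi>\<in>set_pmf (dist I). legal I \<psi> (\<pi> (observed I \<psi> {root I})) [root I])"

definition policy_weight :: "'v rcds \<Rightarrow> 'v policy \<Rightarrow> 'v full \<Rightarrow> real" where
  "policy_weight I \<pi> \<psi> = sum (weight I) (set (run I \<pi> \<psi>))"

definition w_avg :: "'v rcds \<Rightarrow> 'v policy \<Rightarrow> real" where
  "w_avg I \<pi> = (\<Sum>\<psi>\<in>full_realizations I. pmf (dist I) \<psi> * policy_weight I \<pi> \<psi>)"


section \<open>The algorithm\<close>

text \<open>In the following, \<open>W\<close> is the node set of the current graph, which is always the subgraph
  of the input graph induced by \<open>W\<close>; \<open>U\<close> is the set of chosen nodes and \<open>\<phi>\<close> the realization at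
  the beginning of the round.\<close>

definition likely :: "'v rcds \<Rightarrow> 'v set \<Rightarrow> 'v set \<Rightarrow> 'v realization \<Rightarrow> 'v set" where
  "likely I W U \<phi> = {v \<in> W - U. (\<Sum>\<psi> | \<psi> \<in> Psi I \<phi> \<and> v \<in> active \<psi>. cond_prob I \<phi> \<psi>) > 1/2}"

definition region :: "'v rcds \<Rightarrow> 'v set \<Rightarrow> 'v set \<Rightarrow> 'v realization \<Rightarrow> 'v set" where
  "region I W U \<phi> = component (induced (induced (edges I) W) (U \<union> likely I W U \<phi>)) (root I)"

text \<open>The prediction for the neighborhood of \<open>v\<close>.  The nodes of \<open>U\<close> are not in
  \<^const>\<open>likely\<close>, but they are known to be active; predicting them to be inactive would
  contradict the observations already made.\<close>

definition xi :: "'v rcds \<Rightarrow> 'v set \<Rightarrow> 'v set \<Rightarrow> 'v realization \<Rightarrow> 'v \<Rightarrow> 'v realization" where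
  "xi I W U \<phi> v =
     (\<lambda>u. if u \<in> nbh (induced (edges I) W) v then Some (u \<in> U \<union> likely I W U \<phi>) else None)"

definition Psi_pred ::
  "'v rcds \<Rightarrow> 'v set \<Rightarrow> 'v set \<Rightarrow> 'v realization \<Rightarrow> 'v set \<Rightarrow> 'v full set" where
  "Psi_pred I W U \<phi> H' = {\<psi> \<in> Psi I \<phi>. \<forall>v\<in>H'. extends \<psi> (xi I W U \<phi> v)}"

definition f_plt ::
  "'v rcds \<Rightarrow> 'v set \<Rightarrow> 'v set \<Rightarrow> 'v realization \<Rightarrow> 'v set \<Rightarrow> real" where
  "f_plt I W U \<phi> X =
     real (card ((W - dom \<phi>) \<inter> nbhs (induced (edges I) W) X)) +
     (\<Sum>v\<in>(W - dom \<phi>) - nbhs (induced (edges I) W) X.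
        1 - (\<Sum>\<psi> | \<psi> \<in> Psi_pred I W U \<phi> (X \<inter> likely I W U \<phi>) \<and> same_comp I \<psi> v (root I).
               pmf (dist I) \<psi>))"

definition f_plr ::
  "'v rcds \<Rightarrow> 'v set \<Rightarrow> 'v set \<Rightarrow> 'v realization \<Rightarrow> 'v set \<Rightarrow> real" where
  "f_plr I W U \<phi> X =
     min (1/2) (1 - (\<Sum>\<psi>\<in>Psi_pred I W U \<phi> (X \<inter> likely I W U \<phi>). cond_prob I \<phi> \<psi>))"

definition round_weight :: "'v rcds \<Rightarrow> 'v set \<Rightarrow> 'v \<Rightarrow> real" where
  "round_weight I U v = (if v \<in> U then 0 else weight I v)"

definition H_plt ::
  "'v rcds \<Rightarrow> 'v steiner_alg \<Rightarrow> 'v set \<Rightarrow> 'v set \<Rightarrow> 'v realization \<Rightarrow> 'v set" where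
  "H_plt I S W U \<phi> =
     likely I W U \<phi> \<inter>
     fst (S (region I W U \<phi>) (induced (edges I) (region I W U \<phi>)) (root I) (round_weight I U)
           (\<lambda>X. multiplier I * (f_plt I W U \<phi> X - f_plt I W U \<phi> {})))"

definition H_plr ::
  "'v rcds \<Rightarrow> 'v steiner_alg \<Rightarrow> 'v set \<Rightarrow> 'v set \<Rightarrow> 'v realization \<Rightarrow> 'v set" where
  "H_plr I S W U \<phi> =
     (if f_plr I W U \<phi> (region I W U \<phi>) < 1/2 then likely I W U \<phi>
      else likely I W U \<phi> \<inter>
        fst (S (region I W U \<phi>) (induced (edges I) (region I W U \<phi>)) (root I) (round_weight I U)
              (\<lambda>X. 2 * multiplier I * prob_of I \<phi> * f_plr I W U \<phi> X)))"

text \<open>Ties are broken in favor of \<^const>\<open>H_plt\<close>: unlike \<^const>\<open>H_plt\<close>, the set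
  \<^const>\<open>likely\<close> may contain nodes that cannot be reached within the round.\<close>

definition H_star ::
  "'v rcds \<Rightarrow> 'v steiner_alg \<Rightarrow> 'v set \<Rightarrow> 'v set \<Rightarrow> 'v realization \<Rightarrow> 'v set" where
  "H_star I S W U \<phi> =
     (if sum (weight I) (H_plt I S W U \<phi>) \<le> sum (weight I) (H_plr I S W U \<phi>)
      then H_plt I S W U \<phi> else H_plr I S W U \<phi>)"

definition reveal ::
  "'v rcds \<Rightarrow> 'v full \<Rightarrow> 'v set \<Rightarrow> 'v \<Rightarrow> 'v realization \<Rightarrow> 'v realization" where
  "reveal I \<psi> W v \<phi> =
     (\<lambda>u. if u \<in> nbh (induced (edges I) W) v - dom \<phi> then Some (\<psi> u) else \<phi> u)"

text \<open>The inner loop of a round under \<open>\<psi>\<close>, for the set \<open>Hs\<close> to be chosen and the prediction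
  \<open>x\<close>: \<open>sweep I \<psi> W Hs x us \<phi> us' \<phi>'\<close> means that the loop, entered with the sequence \<open>us\<close> of
  chosen nodes and the realization \<open>\<phi>\<close>, can be left with \<open>us'\<close> and \<open>\<phi>'\<close>.\<close>

inductive sweep ::
  "'v rcds \<Rightarrow> 'v full \<Rightarrow> 'v set \<Rightarrow> 'v set \<Rightarrow> ('v \<Rightarrow> 'v realization) \<Rightarrow>
   'v list \<Rightarrow> 'v realization \<Rightarrow> 'v list \<Rightarrow> 'v realization \<Rightarrow> bool"
  for I :: "'v rcds" and \<psi> :: "'v full" and W :: "'v set" and Hs :: "'v set"
    and x :: "'v \<Rightarrow> 'v realization"
where
  finished: "Hs \<subseteq> set us \<Longrightarrow> sweep I \<psi> W Hs x us \<phi> us \<phi>"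
| mismatch:
    "\<lbrakk> v \<in> (Hs - set us) \<inter> nbhs (induced (edges I) W) (set us);
       \<exists>u\<in>nbh (induced (edges I) W) v. reveal I \<psi> W v \<phi> u \<noteq> x v u \<rbrakk>
     \<Longrightarrow> sweep I \<psi> W Hs x us \<phi> (us @ [v]) (reveal I \<psi> W v \<phi>)"
| match:
    "\<lbrakk> v \<in> (Hs - set us) \<inter> nbhs (induced (edges I) W) (set us);
       \<forall>u\<in>nbh (induced (edges I) W) v. reveal I \<psi> W v \<phi> u = x v u;
       sweep I \<psi> W Hs x (us @ [v]) (reveal I \<psi> W v \<phi>) us' \<phi>' \<rbrakk>
     \<Longrightarrow> sweep I \<psi> W Hs x us \<phi> us' \<phi>'"

definition prune :: "'v rcds \<Rightarrow> 'v set \<Rightarrow> 'v realization \<Rightarrow> 'v set" where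
  "prune I W \<phi> =
     component (induced (edges I) {u \<in> W. \<exists>\<psi>\<in>Psi I \<phi>. \<psi> u}) (root I)"

text \<open>\<open>exec I S \<psi> W us \<phi> res\<close>: under \<open>\<psi>\<close>, the main loop entered with the current graph \<open>W\<close>,
  the sequence \<open>us\<close> of chosen nodes and the realization \<open>\<phi>\<close> can end with the sequence \<open>res\<close>.\<close>

inductive exec ::
  "'v rcds \<Rightarrow> 'v steiner_alg \<Rightarrow> 'v full \<Rightarrow>
   'v set \<Rightarrow> 'v list \<Rightarrow> 'v realization \<Rightarrow> 'v list \<Rightarrow> bool"
  for I :: "'v rcds" and S :: "'v steiner_alg" and \<psi> :: "'v full"
where
  halt: "W \<subseteq> nbhs (induced (edges I) W) (set us) \<Longrightarrow> exec I S \<psi> W us \<phi> us"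
| round:
    "\<lbrakk> \<not> W \<subseteq> nbhs (induced (edges I) W) (set us);
       sweep I \<psi> W (H_star I S W (set us) \<phi>) (xi I W (set us) \<phi>) us \<phi> us' \<phi>';
       exec I S \<psi> (prune I W \<phi>') us' \<phi>' res \<rbrakk>
     \<Longrightarrow> exec I S \<psi> W us \<phi> res"

text \<open>The inactive neighbors of the root are removed, but their observed state is kept in the
  initial realization.\<close>

definition algorithm_output :: "'v rcds \<Rightarrow> 'v steiner_alg \<Rightarrow> 'v full \<Rightarrow> 'v list \<Rightarrow> bool" where
  "algorithm_output I S \<psi> res \<longleftrightarrow>
     exec I S \<psi> (UNIV - {v \<in> nbh (edges I) (root I). \<not> \<psi> v}) [root I]
       (observed I \<psi> {root I}) res"

text \<open>The policy given by the algorithm is unique up to the order in which the nodes of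
  \<^const>\<open>H_star\<close> are chosen, which the algorithm leaves open.\<close>

definition algorithm_policy :: "'v rcds \<Rightarrow> 'v steiner_alg \<Rightarrow> 'v policy \<Rightarrow> bool" where
  "algorithm_policy I S \<pi> \<longleftrightarrow>
     (\<forall>\<psi>\<in>set_pmf (dist I). algorithm_output I S \<psi> (run I \<pi> \<psi>))"

end

theory Submission
  imports Defs
begin

text \<open>
  Every round but the last at least halves the probability of the
  realizations consistent with the observations: a misprediction reveals an event of conditional
  probability at most one half, and completing \<^const>\<open>H_plr\<close> leaves at most half of the mass by the
  choice of \<^const>\<open>f_plr\<close>.  Completing \<^const>\<open>H_plt\<close> without misprediction leaves a dominated graph.
  Hence at most \<open>1 + lg (1/\<delta>)\<close> rounds take place.

  A single round costs at most \<open>2\<alpha>\<close> times the conditional expected weight of any policy: follow that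
  policy along the predicted observations until it stops or the prediction has lost half of its
  probability.  The active nodes chosen up to then form a feasible tree for one of the two Steiner
  instances, and the policy pays for all of them with conditional probability at least one half.
  The root, which is paid for outside of all rounds, is subtracted from the weight of the compared
  policy in this bound, and so it does not add to the factor.
\<close>

section \<open>Graphs and spanning trees\<close>

text \<open>The algorithm is a relation between runs, open about the order inside a round, while a
  policy is a decision tree that sees only observations. So the statements about runs fix one tree
  \<open>t\<close> for all \<open>\<psi>\<close> in \<open>Psi I \<phi>\<close>, the realizations
  not yet told apart. The bound for a round holds only on average over that class. Since
  realizations leave the same round at different moments, the class is split at every single choice,
  and the summation follows the splitting.

  The logarithm is a potential: \<open>log 2 (prob_of I \<phi> / delta I)\<close> starts at no more
  than \<open>log 2 (1 / delta I)\<close>, drops by at least one with each halving, and is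
  nonnegative while \<open>Psi I \<phi>\<close> is nonempty. The summand 1 pays for the one round
  that need not halve.

  Both objectives are constants minus the mass of what no node of the argument hits, hence coverage
  functions up to scaling and truncation. Pruning is the other complication: \<open>\<phi>\<close>
  need not record the states of removed nodes, so removed neighbors of the current graph must be
  known to be inactive for \<open>\<phi>\<close> to carry all that was observed.\<close>

lemma induced_induced: "induced (induced E A) B = induced E (A \<inter> B)"
  by (auto simp: induced_def)

lemma induced_mono: "A \<subseteq> B \<Longrightarrow> induced E A \<subseteq> induced E B"
  by (auto simp: induced_def)

lemma sym_induced: "sym E \<Longrightarrow> sym (induced E A)"
  by (auto simp: induced_def sym_def)

lemma ugraph_induced: "ugraph V E \<Longrightarrow> finite X \<Longrightarrow> ugraph X (induced E X)"
  by (auto simp: ugraph_def induced_def sym_def irrefl_def)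

lemma nbh_induced: "v \<in> W \<Longrightarrow> nbh (induced E W) v = nbh E v \<inter> W"
  by (auto simp: nbh_def induced_def)

lemma nbhs_induced: "X \<subseteq> W \<Longrightarrow> nbhs (induced E W) X = nbhs E X \<inter> W"
  by (auto simp: nbh_def nbhs_def induced_def)

lemma nbhs_mono: "X \<subseteq> Y \<Longrightarrow> nbhs E X \<subseteq> nbhs E Y"
  by (auto simp: nbhs_def)

lemma component_mono: "E \<subseteq> F \<Longrightarrow> component E v \<subseteq> component F v"
  unfolding component_def using rtrancl_mono[of E F] by auto

lemma component_subset_closed:
  assumes "r \<in> X" "\<And>x u. x \<in> X \<Longrightarrow> (x, u) \<in> E \<Longrightarrow> u \<in> X"
  shows "component E r \<subseteq> X"
proof
  fix v assume "v \<in> component E r"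
  then have "(r, v) \<in> E\<^sup>*" by (simp add: component_def)
  then show "v \<in> X" by induction (use assms in auto)
qed

lemma component_refl: "v \<in> component E v"
  by (simp add: component_def)

lemma component_step: "x \<in> component E r \<Longrightarrow> (x, u) \<in> E \<Longrightarrow> u \<in> component E r"
  by (auto simp: component_def)

lemma component_induced_subset: "r \<in> X \<Longrightarrow> component (induced E X) r \<subseteq> X"
  by (rule component_subset_closed) (auto simp: induced_def)

lemma component_sym: "sym E \<Longrightarrow> u \<in> component E v \<longleftrightarrow> v \<in> component E u"
  unfolding component_def using sym_rtrancl[of E] by (blast dest: symD)

lemma connected_graph_component:
  assumes "sym E" "X \<subseteq> component E r"
  shows "connected_graph X E"
  unfolding connected_graph_def
proof (intro ballI)
  fix u v assume "u \<in> X" "v \<in> X"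
  then have "(r, u) \<in> E\<^sup>*" "(r, v) \<in> E\<^sup>*"
    using assms(2) by (auto simp: component_def)
  moreover have "(u, r) \<in> E\<^sup>*"
    using \<open>(r, u) \<in> E\<^sup>*\<close> sym_rtrancl[OF assms(1)] by (blast dest: symD)
  ultimately show "(u, v) \<in> E\<^sup>*" by simp
qed

lemma component_exit_edge:
  assumes "r \<in> Y" "v \<in> component E r" "v \<notin> Y"
  shows "\<exists>a b. a \<in> Y \<and> b \<notin> Y \<and> (a, b) \<in> E"
proof (rule ccontr)
  assume "\<nexists>a b. a \<in> Y \<and> b \<notin> Y \<and> (a, b) \<in> E"
  then have "component E r \<subseteq> Y"
    using assms(1) by (intro component_subset_closed) auto
  then show False using assms by blast
qed

lemma component_insert:
  assumes "X \<subseteq> component (induced E X) r" "x \<in> X" "(x, v) \<in> E"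
  shows "insert v X \<subseteq> component (induced E (insert v X)) r"
proof -
  have sub: "component (induced E X) r \<subseteq> component (induced E (insert v X)) r"
    by (intro component_mono induced_mono) auto
  moreover have "(x, v) \<in> induced E (insert v X)" using assms by (simp add: induced_def)
  moreover have "x \<in> component (induced E (insert v X)) r" using sub assms by blast
  ultimately have "v \<in> component (induced E (insert v X)) r" by (metis component_step)
  then show ?thesis using sub assms by blast
qed

section \<open>Trees grown leaf by leaf\<close>

lemma acyclic_insert_leaf:
  assumes "F \<subseteq> T \<times> T" "\<nexists>c. cycle F c" "a \<in> T" "b \<notin> T"
  shows "\<not> cycle (insert (a, b) (insert (b, a) F)) c"
proof
  let ?F = "insert (a, b) (insert (b, a) F)" and ?n = "length c"
  assume c: "cycle ?F c"
  then have n: "?n \<ge> 3" and d: "distinct c"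
    and e: "\<And>i. i < ?n \<Longrightarrow> (c ! i, c ! (Suc i mod ?n)) \<in> ?F"
    by (auto simp: cycle_def)
  have ab: "a \<noteq> b" using assms by auto
  show False
  proof (cases "b \<in> set c")
    case False
    have "(c ! i, c ! (Suc i mod ?n)) \<in> F" if "i < ?n" for i
    proof -
      have "c ! i \<in> set c" "c ! (Suc i mod ?n) \<in> set c"
        using n that by (auto intro!: nth_mem mod_less_divisor)
      then show ?thesis using e[OF that] False by auto
    qed
    then show False using assms(2) n d by (auto simp: cycle_def)
  next
    case True
    \<comment> \<open>In a cycle through \<open>b\<close>, predecessor and successor of
      \<open>b\<close> both equal \<open>a\<close>, the only node joined to the leaf. Length at
      least 3 makes these two different positions, against distinctness.\<close>
    then obtain i where i: "i < ?n" "c ! i = b" by (auto simp: in_set_conv_nth)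
    define j where "j = (if Suc i = ?n then 0 else Suc i)"
    define k where "k = (if i = 0 then ?n - 1 else i - 1)"
    have jk: "j < ?n" "k < ?n" "j \<noteq> k" "Suc i mod ?n = j" "Suc k mod ?n = i"
      using i n by (auto simp: j_def k_def)
    have "(b, c ! j) \<in> ?F" using e[OF i(1)] i(2) jk by simp
    then have "c ! j = a" using assms ab by auto
    moreover have "(c ! k, b) \<in> ?F" using e[of k] i(2) jk by simp
    then have "c ! k = a" using assms ab by auto
    ultimately show False using d jk nth_eq_iff_index_eq[of c j k] by simp
  qed
qed

lemma is_tree_insert_leaf:
  assumes "is_tree T F" "a \<in> T" "b \<notin> T"
  shows "is_tree (insert b T) (insert (a, b) (insert (b, a) F))"
proof -
  let ?F = "insert (a, b) (insert (b, a) F)"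
  have F: "finite T" "F \<subseteq> T \<times> T" "sym F" "irrefl F" "connected_graph T F" "\<nexists>c. cycle F c"
    using assms(1) by (auto simp: is_tree_def ugraph_def)
  have "a \<noteq> b" using assms by auto
  have sym: "sym ?F" using F(3) by (auto simp: sym_def)
  have "T \<subseteq> component F a"
    using F(5) assms(2) by (auto simp: connected_graph_def component_def)
  also have "\<dots> \<subseteq> component ?F a" by (rule component_mono) auto
  finally have "insert b T \<subseteq> component ?F a"
    using component_step[OF component_refl, of a b ?F] by auto
  then have "connected_graph (insert b T) ?F"
    by (rule connected_graph_component[OF sym])
  moreover have "ugraph (insert b T) ?F"
    using F sym \<open>a \<noteq> b\<close> assms by (auto simp: ugraph_def irrefl_def)
  ultimately show ?thesis
    using acyclic_insert_leaf[OF F(2) F(6) assms(2,3)] by (auto simp: is_tree_def)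
qed

lemma is_tree_singleton: "is_tree {r} {}"
  by (auto simp: is_tree_def ugraph_def connected_graph_def cycle_def sym_def irrefl_def
      intro!: exI[of _ 0])

text \<open>A largest subset of \<open>X\<close> that contains \<open>r\<close> and carries a tree
  inside \<open>F\<close> is \<open>X\<close> itself: otherwise an edge leaving it attaches one more
  leaf.\<close>

lemma spanning_tree_exists:
  assumes "ugraph X F" "r \<in> X" "X \<subseteq> component F r"
  shows "\<exists>T\<subseteq>F. is_tree X T"
proof -
  define P where "P Y \<longleftrightarrow> r \<in> Y \<and> Y \<subseteq> X \<and> (\<exists>T\<subseteq>F. is_tree Y T)" for Y
  have fin: "finite X" using assms(1) by (simp add: ugraph_def)
  have "P {r}" using assms(2) is_tree_singleton[of r] by (auto simp: P_def intro!: exI[of _ "{}"])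
  moreover have "\<forall>Z. P Z \<longrightarrow> card Z < Suc (card X)"
    using card_mono[OF fin] by (simp add: P_def le_imp_less_Suc)
  ultimately obtain Y where Y: "P Y" and max: "\<And>Z. P Z \<Longrightarrow> card Z \<le> card Y"
    using ex_has_greatest_nat[of P "{r}" card "Suc (card X)"] by blast
  then obtain T where T: "r \<in> Y" "Y \<subseteq> X" "T \<subseteq> F" "is_tree Y T" by (auto simp: P_def)
  have "Y = X"
  proof (rule ccontr)
    assume "Y \<noteq> X"
    then obtain v where v: "v \<in> component F r" "v \<notin> Y" using T assms(3) by auto
    then obtain a b where ab: "a \<in> Y" "b \<notin> Y" "(a, b) \<in> F"
      using component_exit_edge[OF T(1) v] by blast
    then have ba: "(b, a) \<in> F" "b \<in> X" using assms(1) by (auto simp: ugraph_def sym_def)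
    have "insert (a, b) (insert (b, a) T) \<subseteq> F" using ab ba T by blast
    then have "P (insert b Y)"
      unfolding P_def using T ba is_tree_insert_leaf[OF T(4) ab(1,2)] by blast
    then have "card (insert b Y) \<le> card Y" by (rule max)
    then show False using ab(2) finite_subset[OF T(2) fin] by simp
  qed
  then show ?thesis using T by auto
qed


section \<open>Polymatroids counting what is hit\<close>

text \<open>\<open>P a x\<close> is to be read as "\<open>x\<close> does not hit \<open>a\<close>",
  so this is the mass left uncovered by \<open>X\<close>; its drop below the value at the empty set
  is a weighted coverage function.\<close>

definition avoid_sum :: "'a set \<Rightarrow> ('a \<Rightarrow> 'v \<Rightarrow> bool) \<Rightarrow> ('a \<Rightarrow> real) \<Rightarrow> 'v set \<Rightarrow> real" where
  "avoid_sum A P c X = (\<Sum>a | a \<in> A \<and> (\<forall>x\<in>X. P a x). c a)"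

text \<open>The items avoiding \<open>X \<union> Y\<close> are those avoiding both \<open>X\<close>
  and \<open>Y\<close>, while the items avoiding \<open>X\<close> or \<open>Y\<close> all avoid
  \<open>X \<inter> Y\<close>. So the uncovered mass is supermodular and the covered mass
  submodular; the factor \<open>m\<close> makes it integral.\<close>

lemma polymatroid_avoid_sum:
  assumes "finite A" "\<And>a. a \<in> A \<Longrightarrow> 0 \<le> c a" "\<And>a. a \<in> A \<Longrightarrow> m * c a \<in> \<int>" "0 \<le> m"
  shows "polymatroid V (\<lambda>X. m * (avoid_sum A P c {} - avoid_sum A P c X))"
proof -
  define B where "B X = {a \<in> A. \<forall>x\<in>X. P a x}" for X
  have S: "avoid_sum A P c X = sum c (B X)" for X by (simp add: avoid_sum_def B_def)
  have fin: "finite (B X)" and BA: "B X \<subseteq> A" for X using assms(1) by (auto simp: B_def)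
  have int: "m * sum c (B X) \<in> \<int>" for X
    unfolding sum_distrib_left using assms(3) BA by (intro Ints_sum) auto
  have mono: "sum c (B Y) \<le> sum c (B X)" if "X \<subseteq> Y" for X Y
    using that assms(2) fin by (intro sum_mono2) (auto simp: B_def)
  have super: "sum c (B X) + sum c (B Y) \<le> sum c (B (X \<union> Y)) + sum c (B (X \<inter> Y))" for X Y
  proof -
    have "sum c (B X) + sum c (B Y) = sum c (B X \<union> B Y) + sum c (B X \<inter> B Y)"
      by (rule sum.union_inter[symmetric]) (auto simp: fin)
    also have "B X \<inter> B Y = B (X \<union> Y)" by (auto simp: B_def)
    also have "sum c (B X \<union> B Y) \<le> sum c (B (X \<inter> Y))"
      using assms(2) fin by (intro sum_mono2) (auto simp: B_def)
    finally show ?thesis by simp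
  qed
  show ?thesis
    unfolding polymatroid_def S
  proof (intro conjI allI impI)
    fix X show "m * (sum c (B {}) - sum c (B X)) \<in> \<int>"
      unfolding right_diff_distrib by (intro Ints_diff int)
  next
    fix X Y :: "'b set" assume "X \<subseteq> Y \<and> Y \<subseteq> V"
    then show "m * (sum c (B {}) - sum c (B X)) \<le> m * (sum c (B {}) - sum c (B Y))"
      using mono[of X Y] assms(4) by (intro mult_left_mono) auto
  next
    fix X Y
    have "m * (sum c (B X) + sum c (B Y)) \<le> m * (sum c (B (X \<union> Y)) + sum c (B (X \<inter> Y)))"
      using super assms(4) by (intro mult_left_mono) auto
    then show "m * (sum c (B {}) - sum c (B (X \<union> Y))) + m * (sum c (B {}) - sum c (B (X \<inter> Y)))
      \<le> m * (sum c (B {}) - sum c (B X)) + m * (sum c (B {}) - sum c (B Y))"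
      by (simp add: algebra_simps)
  qed simp
qed

lemma polymatroid_truncate:
  assumes "polymatroid V f" "k \<in> \<int>" "0 \<le> k"
  shows "polymatroid V (\<lambda>X. min k (f X))"
  unfolding polymatroid_def
proof (intro conjI allI impI)
  show "min k (f {}) = 0" using assms by (simp add: polymatroid_def)
next
  fix X assume "X \<subseteq> V"
  then show "min k (f X) \<in> \<int>" using assms by (auto simp: polymatroid_def min_def)
next
  fix X Y assume "X \<subseteq> Y \<and> Y \<subseteq> V"
  then have "f X \<le> f Y" using assms by (simp add: polymatroid_def)
  then show "min k (f X) \<le> min k (f Y)" by auto
next
  fix X Y assume XY: "X \<subseteq> V \<and> Y \<subseteq> V"
  then have "f (X \<union> Y) + f (X \<inter> Y) \<le> f X + f Y"
    using assms by (simp add: polymatroid_def)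
  moreover have "f (X \<inter> Y) \<le> f X" "f (X \<inter> Y) \<le> f Y" "f X \<le> f (X \<union> Y)" "f Y \<le> f (X \<union> Y)"
    using assms(1) XY by (auto simp: polymatroid_def)
  ultimately show "min k (f (X \<union> Y)) + min k (f (X \<inter> Y)) \<le> min k (f X) + min k (f Y)"
    by (auto simp: min_def)
qed

text \<open>On a one-node graph with weight 1 every feasible tree weighs 1, so the guarantee reads
  \<open>1 \<le> \<alpha>\<close>. The signs in later estimates rest on this, and so does the
  treatment of the root's weight.\<close>

lemma steiner_approx_ge_1:
  fixes S :: "'v steiner_alg"
  assumes "steiner_approx \<alpha> S"
  shows "1 \<le> \<alpha>"
proof -
  let ?r = "undefined :: 'v"
  let ?w = "\<lambda>_ :: 'v. 1 :: real" and ?f = "\<lambda>_ :: 'v set. 0 :: real"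
  have T: "steiner_feasible {?r} {} ?r ?f ({?r}, {})"
    using is_tree_singleton by (simp add: steiner_feasible_def)
  moreover have "ugraph {?r} {}" by (simp add: ugraph_def sym_def irrefl_def)
  moreover have "polymatroid {?r} ?f" by (simp add: polymatroid_def)
  ultimately have S: "steiner_feasible {?r} {} ?r ?f (S {?r} {} ?r ?w ?f) \<and>
      (\<forall>T. steiner_feasible {?r} {} ?r ?f T \<longrightarrow>
        sum ?w (fst (S {?r} {} ?r ?w ?f)) \<le> \<alpha> * sum ?w (fst T))"
    by (intro assms[unfolded steiner_approx_def, rule_format]) auto
  then have "fst (S {?r} {} ?r ?w ?f) = {?r}" by (auto simp: steiner_feasible_def)
  with S T show ?thesis by fastforce
qed

text \<open>Comparison with trees becomes comparison with connected node sets, since each of these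
  has a spanning tree; \<open>V\<close> itself shows that the instance is feasible.\<close>

lemma steiner_approx_connected:
  assumes "steiner_approx \<alpha> S" "ugraph V E" "r \<in> V" "V \<subseteq> component E r"
    and "\<And>v. v \<in> V \<Longrightarrow> 0 \<le> w v" "polymatroid V f"
  shows "steiner_feasible V E r f (S V E r w f)"
    and "\<And>Y. r \<in> Y \<Longrightarrow> Y \<subseteq> V \<Longrightarrow> Y \<subseteq> component (induced E Y) r \<Longrightarrow> f Y = f V \<Longrightarrow>
           sum w (fst (S V E r w f)) \<le> \<alpha> * sum w Y"
proof -
  have tree: "\<exists>T. steiner_feasible V E r f (Y, T)"
    if "r \<in> Y" "Y \<subseteq> V" "Y \<subseteq> component (induced E Y) r" "f Y = f V" for Y
  proof -
    have "finite Y" using \<open>Y \<subseteq> V\<close> assms(2) finite_subset by (auto simp: ugraph_def)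
    then obtain T where "T \<subseteq> induced E Y" "is_tree Y T"
      using spanning_tree_exists[OF ugraph_induced[OF assms(2)] \<open>r \<in> Y\<close> \<open>Y \<subseteq> component (induced E Y) r\<close>]
      by auto
    then show ?thesis using that by (auto simp: steiner_feasible_def induced_def)
  qed
  have "induced E V = E" using assms(2) by (auto simp: ugraph_def induced_def)
  then have ex: "\<exists>T. steiner_feasible V E r f T" using tree[of V] assms(3,4) by auto
  have S: "steiner_feasible V E r f (S V E r w f) \<and> (\<forall>T. steiner_feasible V E r f T \<longrightarrow>
      sum w (fst (S V E r w f)) \<le> \<alpha> * sum w (fst T))"
    by (rule assms(1)[unfolded steiner_approx_def, rule_format]) (use assms ex in blast)
  then show "steiner_feasible V E r f (S V E r w f)" by blast
  fix Y assume "r \<in> Y" "Y \<subseteq> V" "Y \<subseteq> component (induced E Y) r" "f Y = f V"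
  then obtain T where "steiner_feasible V E r f (Y, T)" using tree by blast
  then show "sum w (fst (S V E r w f)) \<le> \<alpha> * sum w Y" using S by (metis fst_conv)
qed


section \<open>Realizations and probabilities\<close>

lemma common_denominator:
  assumes "finite A" "\<And>a. a \<in> A \<Longrightarrow> q a \<in> \<rat> \<and> (0::real) \<le> q a"
  shows "\<exists>m::nat. 0 < m \<and> (\<forall>a\<in>A. real m * q a \<in> \<nat>)"
  using assms
proof (induction A rule: finite_induct)
  case empty
  then show ?case by (auto intro: exI[of _ 1])
next
  case (insert a A)
  then obtain m :: nat where m: "0 < m" "\<And>b. b \<in> A \<Longrightarrow> real m * q b \<in> \<nat>" by auto
  obtain k n :: nat where n: "n \<noteq> 0" "\<bar>q a\<bar> = real k / real n"
    using insert.prems[of a] Rats_abs_nat_div_natE[of "q a"] by blast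
  have "q a = real k / real n" using n insert.prems[of a] by auto
  then have "real (m * n) * q a = real (m * k)" using n by simp
  then have "real (m * n) * q a \<in> \<nat>" by (metis of_nat_in_Nats)
  moreover have "real (m * n) * q b \<in> \<nat>" if "b \<in> A" for b
  proof -
    have "real (m * n) * q b = real n * (real m * q b)" by simp
    then show ?thesis using m(2)[OF that] by (metis Nats_mult of_nat_in_Nats)
  qed
  ultimately show ?case using m n by (intro exI[of _ "m * n"]) auto
qed

locale rcds_instance =
  fixes I :: "('v::finite) rcds"
  assumes robust: "robust_cds I"
begin

abbreviation "E \<equiv> edges I"
abbreviation "r \<equiv> root I"
abbreviation "w \<equiv> weight I"
abbreviation "p \<equiv> pmf (dist I)"

lemma ugraph_E: "ugraph UNIV E" and sym_E: "sym E" and w_nonneg: "0 \<le> w v"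
  using robust by (auto simp: robust_cds_def ugraph_def)

lemma support_full: "\<psi> \<in> set_pmf (dist I) \<Longrightarrow> \<psi> \<in> full_realizations I"
  using robust by (auto simp: robust_cds_def)

lemma root_active: "\<psi> \<in> Psi I \<phi> \<Longrightarrow> \<psi> r"
  by (simp add: Psi_def full_realizations_def)

lemma Psi_iff: "\<psi> \<in> Psi I \<phi> \<longleftrightarrow> \<psi> \<in> set_pmf (dist I) \<and> extends \<psi> \<phi>"
  using support_full by (auto simp: Psi_def pmf_positive_iff)

lemma Psi_state: "\<psi> \<in> Psi I \<phi> \<Longrightarrow> \<phi> v = Some b \<Longrightarrow> \<psi> v = b"
  by (force simp: Psi_def extends_def)

lemma Psi_pos: "\<psi> \<in> Psi I \<phi> \<Longrightarrow> 0 < p \<psi>"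
  by (simp add: Psi_def)

lemma prob_of_eq: "prob_of I \<phi> = sum p (Psi I \<phi>)"
  unfolding prob_of_def Psi_def
  by (rule sum.mono_neutral_right) (auto simp: less_le)

lemma prob_of_pos: "Psi I \<phi> \<noteq> {} \<Longrightarrow> 0 < prob_of I \<phi>"
  unfolding prob_of_eq by (intro sum_pos) (auto simp: Psi_pos)

lemma prob_of_le_1: "prob_of I \<phi> \<le> 1"
proof -
  have "prob_of I \<phi> \<le> sum p UNIV" unfolding prob_of_eq by (rule sum_mono2) auto
  also have "\<dots> = 1" by (rule sum_pmf_eq_1) auto
  finally show ?thesis .
qed

lemma sum_cond_prob: "sum (cond_prob I \<phi>) A = sum p A / prob_of I \<phi>"
  by (simp add: cond_prob_def sum_divide_distrib)

lemma delta_props: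
  shows delta_pos: "0 < delta I" and delta_le: "0 < p \<psi> \<Longrightarrow> delta I \<le> p \<psi>"
proof -
  let ?D = "{p \<psi> |\<psi>. p \<psi> > 0}"
  have fin: "finite ?D" by simp
  obtain \<psi>' where "\<psi>' \<in> set_pmf (dist I)" using set_pmf_not_empty[of "dist I"] by blast
  then have "?D \<noteq> {}" by (auto simp: pmf_positive_iff)
  then have "delta I \<in> ?D" unfolding delta_def by (rule Min_in[OF fin])
  then show "0 < delta I" by auto
  show "0 < p \<psi> \<Longrightarrow> delta I \<le> p \<psi>" unfolding delta_def by (rule Min_le[OF fin]) auto
qed

lemma delta_le_prob_of: "Psi I \<phi> \<noteq> {} \<Longrightarrow> delta I \<le> prob_of I \<phi>"
proof -
  assume "Psi I \<phi> \<noteq> {}"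
  then obtain \<psi> where \<psi>: "\<psi> \<in> Psi I \<phi>" by auto
  then have "delta I \<le> p \<psi>" by (simp add: Psi_pos delta_le)
  also have "\<dots> \<le> sum p (Psi I \<phi>)" using \<psi> by (intro member_le_sum) auto
  finally show ?thesis by (simp add: prob_of_eq)
qed

text \<open>A set of positive reals need not have a least element. Scaling by the positive
  probability of one fixed \<open>\<psi>'\<close> maps the admissible multipliers to naturals and
  preserves their order, so one with least image is the least.\<close>

lemma multiplier_props:
  shows multiplier_pos: "0 < multiplier I"
    and multiplier_pmf: "multiplier I * p \<psi> \<in> \<nat>"
proof -
  let ?K = "\<lambda>m. m > 0 \<and> (\<forall>\<psi>\<in>full_realizations I. m * p \<psi> \<in> \<nat>)"
  obtain n :: nat where "0 < n" "\<forall>\<psi>\<in>full_realizations I. real n * p \<psi> \<in> \<nat>"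
    using common_denominator[of "full_realizations I" p] robust by (auto simp: robust_cds_def)
  then have n: "?K (real n)" by simp
  obtain \<psi>' where "\<psi>' \<in> set_pmf (dist I)" using set_pmf_not_empty[of "dist I"] by blast
  then have \<psi>': "\<psi>' \<in> full_realizations I" "0 < p \<psi>'"
    by (auto simp: support_full pmf_positive_iff)
  define J where "J k \<longleftrightarrow> (\<exists>m. ?K m \<and> m * p \<psi>' = real k)" for k :: nat
  have J: "\<exists>k. m * p \<psi>' = real k \<and> J k" if "?K m" for m
    using that \<psi>'(1) unfolding J_def Nats_def by blast
  then have "J (LEAST k. J k)" using n by (metis LeastI_ex)
  then obtain m where m: "?K m" "m * p \<psi>' = real (LEAST k. J k)" unfolding J_def by blast
  have "multiplier I = m"
    unfolding multiplier_def
  proof (rule Least_equality)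
    show "?K m" by (rule m(1))
    fix m' assume "?K m'"
    then obtain k where k: "m' * p \<psi>' = real k" "J k" using J by blast
    then have "(LEAST k. J k) \<le> k" by (intro Least_le)
    then have "m * p \<psi>' \<le> m' * p \<psi>'" using m(2) k(1) by simp
    then show "m \<le> m'" using \<psi>'(2) by simp
  qed
  with m(1) show "0 < multiplier I" by simp
  show "multiplier I * p \<psi> \<in> \<nat>"
  proof (cases "\<psi> \<in> full_realizations I")
    case True
    then show ?thesis using m(1) \<open>multiplier I = m\<close> by simp
  next
    case False
    then have "\<psi> \<notin> set_pmf (dist I)" using support_full by blast
    then show ?thesis by (simp add: set_pmf_iff)
  qed
qed

end


section \<open>The states of the algorithm\<close>

text \<open>The invariant of a run, inside rounds as well as between them. Only neighbors within
  \<open>W\<close> have to be recorded in \<open>\<phi>\<close>; \<open>boundary\<close> supplies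
  the states of the others, since a removed neighbor of the current graph is inactive under all
  consistent realizations.\<close>

locale cds_state = rcds_instance +
  fixes W U :: "'a set" and \<phi> :: "'a realization"
  assumes root_chosen: "r \<in> U"
    and chosen_subset: "U \<subseteq> W"
    and chosen_connected: "U \<subseteq> component (induced E U) r"
    and chosen_active: "u \<in> U \<Longrightarrow> \<phi> u = Some True"
    and dom_subset: "dom \<phi> \<subseteq> nbhs E U"
    and nbhs_known: "nbhs E U \<inter> W \<subseteq> dom \<phi>"
    and boundary: "\<psi> \<in> Psi I \<phi> \<Longrightarrow> x \<in> W \<Longrightarrow> (x, u) \<in> E \<Longrightarrow> u \<notin> W \<Longrightarrow> \<not> \<psi> u"
    and Psi_nonempty: "Psi I \<phi> \<noteq> {}"
begin

lemma Psi_chosen: "\<psi> \<in> Psi I \<phi> \<Longrightarrow> u \<in> U \<Longrightarrow> \<psi> u"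
  using chosen_active Psi_state by fastforce

lemma component_active_subset:
  assumes "\<psi> \<in> Psi I \<phi>"
  shows "component (induced E (active \<psi>)) r \<subseteq> W"
proof (rule component_subset_closed)
  show "r \<in> W" using root_chosen chosen_subset by auto
  fix x u assume "x \<in> W" "(x, u) \<in> induced E (active \<psi>)"
  then show "u \<in> W" using boundary[OF assms, of x u] by (auto simp: induced_def active_def)
qed

text \<open>By \<open>boundary\<close> the true observations depend on \<open>\<phi>\<close>,
  \<open>W\<close> and \<open>U\<close> only. So a policy that has chosen \<open>U\<close> cannot
  distinguish the realizations in \<open>Psi I \<phi>\<close>.\<close>

lemma observed_chosen:
  assumes "\<psi> \<in> Psi I \<phi>"
  shows "observed I \<psi> U = (\<lambda>u. if u \<in> nbhs E U then if u \<in> W then \<phi> u else Some False else None)"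
proof -
  have act: "U \<inter> active \<psi> = U" using Psi_chosen[OF assms] by (auto simp: active_def)
  have sub: "U \<subseteq> nbhs E U" by (auto simp: nbhs_def nbh_def)
  have "Some (\<psi> u) = (if u \<in> W then \<phi> u else Some False)" if u: "u \<in> nbhs E U" for u
  proof (cases "u \<in> W")
    case True
    then obtain b where "\<phi> u = Some b" using u nbhs_known by blast
    then show ?thesis using True Psi_state[OF assms] by auto
  next
    case False
    then obtain x where "x \<in> U" "(x, u) \<in> E"
      using u chosen_subset by (auto simp: nbhs_def nbh_def)
    then show ?thesis using False boundary[OF assms, of x u] chosen_subset by auto
  qed
  then show ?thesis unfolding observed_def act using sub by (intro ext) auto
qed

lemma Psi_observed:
  assumes "\<psi> \<in> Psi I \<phi>" "\<psi>' \<in> Psi I (observed I \<psi> U)"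
  shows "\<psi>' \<in> Psi I \<phi>"
proof -
  have "extends \<psi>' \<phi>"
    unfolding extends_def
  proof
    fix u assume u: "u \<in> dom \<phi>"
    then have "\<phi> u = Some (\<psi> u)" using assms(1) by (auto simp: Psi_def extends_def)
    moreover have "observed I \<psi> U u = Some (\<psi> u)"
      using u dom_subset Psi_chosen[OF assms(1)]
      by (auto simp: observed_def nbhs_def active_def)
    then have "\<psi>' u = \<psi> u" using Psi_state[OF assms(2)] by blast
    ultimately show "\<phi> u = Some (\<psi>' u)" by simp
  qed
  then show ?thesis using assms(2) by (simp add: Psi_iff)
qed

text \<open>Looking at the current graph alone suffices for stopping: the active component of the
  root never leaves \<open>W\<close>, and whatever fits the full observations also fits
  \<open>\<phi>\<close>.\<close>

lemma determined_if_dominated: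
  assumes "W \<subseteq> nbhs E U" "\<psi> \<in> Psi I \<phi>"
  shows "determined I (observed I \<psi> U) U"
  unfolding determined_def
proof
  fix \<psi>' assume "\<psi>' \<in> Psi I (observed I \<psi> U)"
  then have \<psi>': "\<psi>' \<in> Psi I \<phi>" by (rule Psi_observed[OF assms(2)])
  have "{v \<in> U. observed I \<psi> U v = Some True} = U"
    using Psi_chosen[OF assms(2)] by (auto simp: observed_def)
  moreover have "solution I \<psi>' U"
    unfolding solution_def
    using Psi_chosen[OF \<psi>'] root_chosen component_active_subset[OF \<psi>'] assms(1)
      connected_graph_component[OF sym_induced[OF sym_E] chosen_connected]
    by (auto simp: active_def)
  ultimately show "solution I \<psi>' {v \<in> U. observed I \<psi> U v = Some True}" by simp
qed

end

text \<open>Pruning removes observed inactive nodes, so this holds between rounds. Inside a round,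
  nodes just seen to be inactive still lie in \<open>W\<close>, which is why it is not part of
  \<open>cds_state\<close>.\<close>

locale round_start = cds_state +
  assumes known_active: "u \<in> dom \<phi> \<Longrightarrow> u \<in> W \<Longrightarrow> \<phi> u = Some True"

lemma (in cds_state) round_start_prune: "round_start I (prune I W \<phi>) U \<phi>"
proof -
  let ?P = "{u \<in> W. \<exists>\<psi>\<in>Psi I \<phi>. \<psi> u}"
  obtain \<psi>0 where \<psi>0: "\<psi>0 \<in> Psi I \<phi>" using Psi_nonempty by blast
  have UP: "U \<subseteq> ?P" using chosen_subset Psi_chosen[OF \<psi>0] \<psi>0 by blast
  have WP: "prune I W \<phi> \<subseteq> ?P"
    unfolding prune_def using UP root_chosen by (intro component_induced_subset) blast
  show ?thesis
  proof unfold_locales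
    show "r \<in> U" by (rule root_chosen)
    show "U \<subseteq> prune I W \<phi>"
      unfolding prune_def using chosen_connected component_mono[OF induced_mono[OF UP]] by blast
    show "U \<subseteq> component (induced E U) r" by (rule chosen_connected)
    show "dom \<phi> \<subseteq> nbhs E U" by (rule dom_subset)
    show "Psi I \<phi> \<noteq> {}" by (rule Psi_nonempty)
    show "nbhs E U \<inter> prune I W \<phi> \<subseteq> dom \<phi>" using nbhs_known WP by blast
    show "\<phi> u = Some True" if "u \<in> U" for u using chosen_active that .
  next
    fix \<psi> x u
    assume *: "\<psi> \<in> Psi I \<phi>" "x \<in> prune I W \<phi>" "(x, u) \<in> E" "u \<notin> prune I W \<phi>"
    show "\<not> \<psi> u"
    proof
      assume "\<psi> u"
      have x: "x \<in> ?P" using * WP by blast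
      then have "u \<in> ?P" using boundary[OF *(1) _ *(3)] \<open>\<psi> u\<close> *(1) by blast
      then have "(x, u) \<in> induced E ?P" using x *(3) by (simp add: induced_def)
      with *(2) have "u \<in> prune I W \<phi>" unfolding prune_def by (rule component_step)
      then show False using *(4) by contradiction
    qed
  next
    fix u assume "u \<in> dom \<phi>" "u \<in> prune I W \<phi>"
    then obtain b \<psi> where "\<phi> u = Some b" "\<psi> \<in> Psi I \<phi>" "\<psi> u" using WP by blast
    then show "\<phi> u = Some True" using Psi_state by metis
  qed
qed


section \<open>The polymatroids of a round\<close>

context round_start
begin

abbreviation "H \<equiv> likely I W U \<phi>"
abbreviation "R \<equiv> region I W U \<phi>"

lemma likely_iff: "v \<in> H \<longleftrightarrow> v \<in> W - U \<and> prob_of I \<phi> < 2 * sum p {\<psi> \<in> Psi I \<phi>. \<psi> v}"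
  using prob_of_pos[OF Psi_nonempty]
  by (auto simp: likely_def sum_cond_prob active_def field_simps)

lemma likely_subset: "H \<subseteq> W" and likely_disjoint: "H \<inter> U = {}"
  by (auto simp: likely_def)

lemma known_likely:
  assumes "u \<in> dom \<phi>" "u \<in> W"
  shows "u \<in> U \<union> H"
proof -
  have "{\<psi> \<in> Psi I \<phi>. \<psi> u} = Psi I \<phi>"
    using known_active[OF assms] Psi_state by fastforce
  then show ?thesis
    using assms prob_of_pos[OF Psi_nonempty] by (auto simp: likely_iff prob_of_eq[symmetric])
qed

lemma region_eq: "R = component (induced E (U \<union> H)) r"
proof -
  have "W \<inter> (U \<union> H) = U \<union> H" using chosen_subset likely_subset by blast
  then show ?thesis by (simp add: region_def induced_induced)
qed

lemma region_subset: "R \<subseteq> U \<union> H"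
  unfolding region_eq using root_chosen by (intro component_induced_subset) auto

lemma root_region: "r \<in> R"
  unfolding region_eq by (rule component_refl)

lemma region_closed:
  assumes "x \<in> R" "(x, u) \<in> E" "u \<in> U \<union> H"
  shows "u \<in> R"
proof -
  have "(x, u) \<in> induced E (U \<union> H)"
    using assms region_subset unfolding induced_def by blast
  with assms(1) show ?thesis unfolding region_eq by (rule component_step)
qed

lemma connected_subset_region:
  assumes "Y \<subseteq> U \<union> H" "Y \<subseteq> component (induced E Y) r"
  shows "Y \<subseteq> R"
  unfolding region_eq using assms component_mono[OF induced_mono[OF assms(1)]] by blast

lemma region_connected: "R \<subseteq> component (induced E R) r"
proof -
  have "component (induced E (U \<union> H)) r \<subseteq> R \<inter> component (induced E R) r"
  proof (rule component_subset_closed)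
    show "r \<in> R \<inter> component (induced E R) r" using root_region component_refl by auto
    fix x u assume x: "x \<in> R \<inter> component (induced E R) r" and e: "(x, u) \<in> induced E (U \<union> H)"
    then have u: "u \<in> R" using region_closed by (auto simp: induced_def)
    then have "(x, u) \<in> induced E R" using x e by (simp add: induced_def)
    from component_step[OF _ this, of r] x have "u \<in> component (induced E R) r" by blast
    with u show "u \<in> R \<inter> component (induced E R) r" by blast
  qed
  then show ?thesis by (simp add: region_eq[symmetric])
qed

text \<open>\<open>Psi_pred\<close> constrains only the neighborhoods of nodes in
  \<open>X \<inter> H\<close>. Around \<open>U\<close> the same rule holds by observation, and
  outside \<open>W\<close> by \<open>boundary\<close>, so one prediction serves the whole input
  graph.\<close>

lemma Psi_pred_nbh:
  assumes "\<psi> \<in> Psi_pred I W U \<phi> X" "x \<in> U \<or> x \<in> X \<inter> H" "u \<in> nbh E x"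
  shows "\<psi> u \<longleftrightarrow> u \<in> U \<union> H"
proof -
  have \<psi>: "\<psi> \<in> Psi I \<phi>" using assms(1) by (simp add: Psi_pred_def)
  have x: "x \<in> W" using assms(2) chosen_subset likely_subset by blast
  show ?thesis
  proof (cases "u \<in> W")
    case False
    then have "(x, u) \<in> E" using assms(3) x by (auto simp: nbh_def)
    then have "\<not> \<psi> u" using boundary[OF \<psi> x] False by blast
    then show ?thesis using False chosen_subset likely_subset by blast
  next
    case u: True
    show ?thesis
    proof (cases "x \<in> U")
      case True
      then have "u \<in> dom \<phi>" using u assms(3) nbhs_known by (auto simp: nbhs_def)
      then show ?thesis using known_likely known_active u Psi_state[OF \<psi>] by blast
    next
      case False
      then have "extends \<psi> (xi I W U \<phi> x)" using assms(1,2) by (simp add: Psi_pred_def)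
      moreover have "xi I W U \<phi> x u = Some (u \<in> U \<union> H)"
        using u assms(3) x by (simp add: xi_def nbh_induced)
      ultimately show ?thesis by (auto simp: extends_def dom_def)
    qed
  qed
qed

text \<open>Where all predictions hold, the next node on an active path from \<open>r\<close> is
  predicted to be active, hence still in \<open>R\<close>. This is what makes \<open>R\<close>
  attain the maximum of \<open>f_plt\<close>.\<close>

lemma component_subset_region:
  assumes "\<psi> \<in> Psi_pred I W U \<phi> (R \<inter> H)"
  shows "component (induced E (active \<psi>)) r \<subseteq> R"
proof (rule component_subset_closed[OF root_region])
  fix x u assume x: "x \<in> R" and e: "(x, u) \<in> induced E (active \<psi>)"
  have "\<psi> u \<longleftrightarrow> u \<in> U \<union> H"
    using x e region_subset by (intro Psi_pred_nbh[OF assms, of x]) (auto simp: nbh_def induced_def)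
  then show "u \<in> R" using x e region_closed by (auto simp: induced_def active_def)
qed

section \<open>The two objectives as weighted coverage\<close>

lemma same_comp_root: "same_comp I \<psi> v r \<longleftrightarrow> \<psi> v \<and> \<psi> r \<and> v \<in> component (induced E (active \<psi>)) r"
  unfolding same_comp_def using component_sym[OF sym_induced[OF sym_E]]
  by (auto simp: active_def)

text \<open>The items to be covered: an unobserved node paired with a realization that connects it
  to the root, weighted by the probability of the realization.\<close>

definition unreached :: "('a \<times> 'a full) set" where
  "unreached = (SIGMA v:W - dom \<phi>. {\<psi> \<in> Psi I \<phi>. same_comp I \<psi> v r})"

text \<open>A pair \<open>(v, \<psi>)\<close> can be hit in two ways: \<open>x\<close> dominates
  \<open>v\<close>, or the prediction around \<open>x\<close> contradicts
  \<open>\<psi>\<close>.\<close>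

definition misses :: "'a \<times> 'a full \<Rightarrow> 'a \<Rightarrow> bool" where
  "misses = (\<lambda>(v, \<psi>) x. v \<notin> nbh (induced E W) x \<and> (x \<in> H \<longrightarrow> extends \<psi> (xi I W U \<phi> x)))"

lemma misses_set:
  "{a \<in> unreached. \<forall>x\<in>X. misses a x} =
   (SIGMA v:(W - dom \<phi>) - nbhs (induced E W) X.
      {\<psi> \<in> Psi_pred I W U \<phi> (X \<inter> H). same_comp I \<psi> v r})"
  by (auto simp: unreached_def misses_def Psi_pred_def nbhs_def)

lemma f_plt_eq:
  "f_plt I W U \<phi> X = real (card (W - dom \<phi>)) - avoid_sum unreached misses (p \<circ> snd) X"
proof -
  let ?D = "W - dom \<phi>" and ?N = "nbhs (induced E W) X"
  let ?B = "\<lambda>v. {\<psi> \<in> Psi_pred I W U \<phi> (X \<inter> H). same_comp I \<psi> v r}"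
  have "avoid_sum unreached misses (p \<circ> snd) X = (\<Sum>v\<in>?D - ?N. sum p (?B v))"
    unfolding avoid_sum_def misses_set by (subst sum.Sigma) (auto simp: split_def)
  moreover have "real (card ?D) = real (card (?D \<inter> ?N)) + real (card (?D - ?N))"
    using card_Int_Diff[of ?D ?N] by simp
  ultimately show ?thesis
    unfolding f_plt_def by (simp add: sum_subtractf)
qed

text \<open>Probabilities in \<open>Psi I \<phi>\<close> are positive, so zero uncovered mass means
  that no pair is left uncovered.\<close>

lemma f_plt_full_iff:
  "f_plt I W U \<phi> X = real (card (W - dom \<phi>)) \<longleftrightarrow>
   (\<forall>v\<in>W - dom \<phi>. \<forall>\<psi>\<in>Psi_pred I W U \<phi> (X \<inter> H).
      same_comp I \<psi> v r \<longrightarrow> v \<in> nbhs (induced E W) X)"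
proof -
  let ?A = "{a \<in> unreached. \<forall>x\<in>X. misses a x}"
  have "f_plt I W U \<phi> X = real (card (W - dom \<phi>)) \<longleftrightarrow> sum (p \<circ> snd) ?A = 0"
    by (simp add: f_plt_eq avoid_sum_def)
  also have "\<dots> \<longleftrightarrow> (\<forall>a\<in>?A. (p \<circ> snd) a = 0)"
    by (rule sum_nonneg_eq_0_iff) auto
  also have "\<dots> \<longleftrightarrow> ?A = {}"
  proof -
    have "(p \<circ> snd) a \<noteq> 0" if "a \<in> ?A" for a
      using that Psi_pos by (fastforce simp: unreached_def)
    then show ?thesis by blast
  qed
  also have "\<dots> \<longleftrightarrow> (\<forall>v\<in>W - dom \<phi>. \<forall>\<psi>\<in>Psi_pred I W U \<phi> (X \<inter> H).
      same_comp I \<psi> v r \<longrightarrow> v \<in> nbhs (induced E W) X)"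
    unfolding misses_set by blast
  finally show ?thesis .
qed

lemma f_plt_region: "f_plt I W U \<phi> R = real (card (W - dom \<phi>))"
  unfolding f_plt_full_iff
proof (intro ballI impI)
  fix v \<psi> assume "\<psi> \<in> Psi_pred I W U \<phi> (R \<inter> H)" "same_comp I \<psi> v r"
  then have "v \<in> R" using component_subset_region by (auto simp: same_comp_root)
  then show "v \<in> nbhs (induced E W) R" by (auto simp: nbhs_def nbh_def)
qed

lemma polymatroid_plt:
  "polymatroid R (\<lambda>X. multiplier I * (f_plt I W U \<phi> X - f_plt I W U \<phi> {}))"
proof -
  have "polymatroid R (\<lambda>X. multiplier I * (avoid_sum unreached misses (p \<circ> snd) {} -
      avoid_sum unreached misses (p \<circ> snd) X))"
    using multiplier_pmf multiplier_pos Nats_subset_Ints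
    by (intro polymatroid_avoid_sum) (auto intro: less_imp_le)
  then show ?thesis by (simp add: f_plt_eq)
qed

lemma Psi_pred_avoid:
  "sum p (Psi_pred I W U \<phi> (X \<inter> H)) =
   avoid_sum (Psi I \<phi>) (\<lambda>\<psi> x. x \<in> H \<longrightarrow> extends \<psi> (xi I W U \<phi> x)) p X"
  unfolding avoid_sum_def Psi_pred_def by (rule arg_cong[of _ _ "sum p"]) auto

lemma f_plr_half_iff:
  "f_plr I W U \<phi> X = 1/2 \<longleftrightarrow> 2 * sum p (Psi_pred I W U \<phi> (X \<inter> H)) \<le> prob_of I \<phi>"
proof -
  have "f_plr I W U \<phi> X = 1/2 \<longleftrightarrow> sum p (Psi_pred I W U \<phi> (X \<inter> H)) / prob_of I \<phi> \<le> 1/2"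
    by (auto simp: f_plr_def sum_cond_prob min_def)
  then show ?thesis using prob_of_pos[OF Psi_nonempty] by (simp add: field_simps)
qed

lemma f_plr_le: "f_plr I W U \<phi> X \<le> 1/2"
  unfolding f_plr_def by (rule min.cobounded1)

text \<open>The constant 2 turns the truncation level 1/2 into
  \<open>multiplier I * prob_of I \<phi>\<close>, an integer; what is truncated is twice the scaled
  covered mass.\<close>

lemma polymatroid_plr:
  "polymatroid R (\<lambda>X. 2 * multiplier I * prob_of I \<phi> * f_plr I W U \<phi> X)"
proof -
  let ?A = "avoid_sum (Psi I \<phi>) (\<lambda>\<psi> x. x \<in> H \<longrightarrow> extends \<psi> (xi I W U \<phi> x)) p"
  have A0: "?A {} = prob_of I \<phi>" by (simp add: avoid_sum_def prob_of_eq)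
  have "polymatroid R (\<lambda>X. 2 * multiplier I * (?A {} - ?A X))"
  proof (intro polymatroid_avoid_sum)
    fix \<psi>
    have "multiplier I * p \<psi> \<in> \<int>" using multiplier_pmf Nats_subset_Ints by blast
    then have "2 * (multiplier I * p \<psi>) \<in> \<int>" by (rule Ints_mult[rotated]) simp
    then show "2 * multiplier I * p \<psi> \<in> \<int>" by (simp add: mult.assoc)
  qed (use multiplier_pos in auto)
  moreover have "multiplier I * prob_of I \<phi> \<in> \<int>"
    unfolding prob_of_eq sum_distrib_left
    using multiplier_pmf Nats_subset_Ints by (intro Ints_sum) auto
  moreover have pos: "0 < multiplier I * prob_of I \<phi>"
    using multiplier_pos prob_of_pos[OF Psi_nonempty] by simp
  ultimately have "polymatroid R
      (\<lambda>X. min (multiplier I * prob_of I \<phi>) (2 * multiplier I * (?A {} - ?A X)))"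
    by (intro polymatroid_truncate) auto
  moreover have "2 * multiplier I * prob_of I \<phi> * f_plr I W U \<phi> X =
      min (multiplier I * prob_of I \<phi>) (2 * multiplier I * (?A {} - ?A X))" for X
  proof -
    have "2 * multiplier I * prob_of I \<phi> * f_plr I W U \<phi> X =
      min (2 * multiplier I * prob_of I \<phi> * (1/2))
          (2 * multiplier I * prob_of I \<phi> * (1 - ?A X / prob_of I \<phi>))"
      unfolding f_plr_def sum_cond_prob Psi_pred_avoid
      using pos by (subst min_mult_distrib_left) auto
    then show ?thesis
      using prob_of_pos[OF Psi_nonempty] by (simp add: A0 algebra_simps)
  qed
  ultimately show ?thesis by simp
qed

text \<open>Nodes of \<open>U\<close> are free under \<open>round_weight\<close>. So the tree weighs
  as much as its likely nodes, and a competing set pays only for what it has outside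
  \<open>U\<close>.\<close>

lemma steiner_region:
  assumes "steiner_approx \<alpha> S" "polymatroid R f"
  defines "T \<equiv> fst (S R (induced E R) r (round_weight I U) f)"
  shows "r \<in> T" "T \<subseteq> R" "f T = f R" "T \<subseteq> component (induced E T) r"
    and "\<And>Y. r \<in> Y \<Longrightarrow> Y \<subseteq> R \<Longrightarrow> Y \<subseteq> component (induced E Y) r \<Longrightarrow> f Y = f R \<Longrightarrow>
           sum w (H \<inter> T) \<le> \<alpha> * sum w (Y - U)"
proof -
  let ?S = "S R (induced E R) r (round_weight I U) f"
  note S = steiner_approx_connected[OF assms(1) ugraph_induced[OF ugraph_E, of R] root_region
      region_connected _ assms(2), of "round_weight I U"]
  have nonneg: "\<And>v. 0 \<le> round_weight I U v" by (simp add: round_weight_def w_nonneg)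
  have f: "steiner_feasible R (induced E R) r f ?S" by (rule S(1)) (auto simp: nonneg)
  then show "r \<in> T" "T \<subseteq> R" "f T = f R" by (auto simp: T_def steiner_feasible_def)
  have t: "is_tree T (snd ?S)" "snd ?S \<subseteq> E"
    using f by (auto simp: T_def steiner_feasible_def induced_def)
  then have "T \<subseteq> component (snd ?S) r"
    using \<open>r \<in> T\<close> by (auto simp: is_tree_def connected_graph_def component_def)
  moreover have "snd ?S \<subseteq> induced E T"
    using t by (auto simp: is_tree_def ugraph_def induced_def)
  ultimately show "T \<subseteq> component (induced E T) r"
    using component_mono[of "snd ?S" "induced E T" r] by simp
  have rw: "sum (round_weight I U) Y = sum w (Y - U)" for Y
    by (rule sum.mono_neutral_cong_right) (auto simp: round_weight_def)
  have "T - U = H \<inter> T" using \<open>T \<subseteq> R\<close> region_subset likely_disjoint by blast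
  then have wT: "sum (round_weight I U) T = sum w (H \<inter> T)" by (simp add: rw)
  fix Y assume Y: "r \<in> Y" "Y \<subseteq> R" "Y \<subseteq> component (induced E Y) r" "f Y = f R"
  then have "induced (induced E R) Y = induced E Y" by (simp add: induced_induced inf.absorb2)
  then have "sum (round_weight I U) (fst ?S) \<le> \<alpha> * sum (round_weight I U) Y"
    using Y by (intro S(2)) (auto simp: nonneg)
  then show "sum w (H \<inter> T) \<le> \<alpha> * sum w (Y - U)" using wT rw T_def by simp
qed

text \<open>The default \<open>H_plr = H\<close> is never selected: \<open>H_plt\<close> is a subset
  of \<open>H\<close>, hence no heavier, and ties go to \<open>H_plt\<close>. So
  \<open>H_star\<close> always consists of the likely nodes of a computed tree on which one of the
  two objectives is attained.\<close>

lemma H_star_tree: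
  assumes "steiner_approx \<alpha> S"
  shows "\<exists>T. H_star I S W U \<phi> = H \<inter> T \<and> r \<in> T \<and> T \<subseteq> R \<and> T \<subseteq> component (induced E T) r \<and>
    (f_plt I W U \<phi> T = real (card (W - dom \<phi>)) \<or> f_plr I W U \<phi> T = 1/2)"
proof (cases "H_star I S W U \<phi> = H_plt I S W U \<phi>")
  case True
  then show ?thesis
    using steiner_region[OF assms polymatroid_plt] f_plt_region multiplier_pos
    unfolding H_plt_def by (intro exI conjI) auto
next
  case False
  then have star: "H_star I S W U \<phi> = H_plr I S W U \<phi>"
    and less: "sum w (H_plr I S W U \<phi>) < sum w (H_plt I S W U \<phi>)"
    by (auto simp: H_star_def split: if_splits)
  have "sum w (H_plt I S W U \<phi>) \<le> sum w H"
    by (rule sum_mono2) (auto simp: H_plt_def w_nonneg)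
  then have "\<not> f_plr I W U \<phi> R < 1/2" using less by (auto simp: H_plr_def)
  then have half: "f_plr I W U \<phi> R = 1/2" using f_plr_le[of R] by simp
  have "2 * multiplier I * prob_of I \<phi> \<noteq> 0"
    using multiplier_pos prob_of_pos[OF Psi_nonempty] by simp
  then show ?thesis
    using steiner_region[OF assms polymatroid_plr] half
    unfolding star H_plr_def by (intro exI conjI) auto
qed

lemma H_star_weight:
  assumes "steiner_approx \<alpha> S" "r \<in> Y" "Y \<subseteq> R" "Y \<subseteq> component (induced E Y) r"
    and "f_plt I W U \<phi> Y = real (card (W - dom \<phi>)) \<or> f_plr I W U \<phi> Y = 1/2"
  shows "sum w (H_star I S W U \<phi>) \<le> \<alpha> * sum w (Y - U)"
  using assms(5)
proof
  assume "f_plt I W U \<phi> Y = real (card (W - dom \<phi>))"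
  then have "sum w (H_plt I S W U \<phi>) \<le> \<alpha> * sum w (Y - U)"
    unfolding H_plt_def using assms f_plt_region
    by (intro steiner_region(5)[OF assms(1) polymatroid_plt]) auto
  then show ?thesis by (auto simp: H_star_def)
next
  assume Y: "f_plr I W U \<phi> Y = 1/2"
  \<comment> \<open>If \<open>Y\<close> attains 1/2, then so does the larger set \<open>R\<close>;
    hence \<open>H_plr\<close> comes from the Steiner subroutine and not from the default.\<close>
  have "Psi_pred I W U \<phi> (R \<inter> H) \<subseteq> Psi_pred I W U \<phi> (Y \<inter> H)"
    using assms(3) by (auto simp: Psi_pred_def)
  then have "sum p (Psi_pred I W U \<phi> (R \<inter> H)) \<le> sum p (Psi_pred I W U \<phi> (Y \<inter> H))"
    by (intro sum_mono2) auto
  then have half: "f_plr I W U \<phi> R = 1/2" using Y unfolding f_plr_half_iff by simp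
  then have "H_plr I S W U \<phi> = H \<inter> fst (S R (induced E R) r (round_weight I U)
      (\<lambda>X. 2 * multiplier I * prob_of I \<phi> * f_plr I W U \<phi> X))"
    by (simp add: H_plr_def)
  then have "sum w (H_plr I S W U \<phi>) \<le> \<alpha> * sum w (Y - U)"
    using assms Y half by (simp only:) (rule steiner_region(5)[OF assms(1) polymatroid_plr], auto)
  then show ?thesis by (auto simp: H_star_def)
qed

lemma H_star_subset: "H_star I S W U \<phi> \<subseteq> H"
  by (auto simp: H_star_def H_plt_def H_plr_def)

text \<open>The tree behind \<open>H_star\<close> contains the chosen root, so some edge of it
  leaves \<open>Z\<close>; as \<open>R\<close> lies in \<open>U \<union> H\<close> and
  \<open>U\<close> in \<open>Z\<close>, the far end is likely. Hence the inner loop never gets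
  stuck.\<close>

lemma H_star_reachable:
  assumes "steiner_approx \<alpha> S" "U \<subseteq> Z" "Z \<subseteq> W" "\<not> H_star I S W U \<phi> \<subseteq> Z"
  shows "\<exists>v. v \<in> (H_star I S W U \<phi> - Z) \<inter> nbhs (induced E W) Z"
proof -
  obtain T where T: "H_star I S W U \<phi> = H \<inter> T" "T \<subseteq> R" "T \<subseteq> component (induced E T) r"
    using H_star_tree[OF assms(1)] by blast
  then obtain v where "v \<in> component (induced E T) r" "v \<notin> Z" using assms(4) by blast
  then obtain a b where "a \<in> Z" "b \<notin> Z" "(a, b) \<in> induced E T"
    using component_exit_edge[of r Z v] root_chosen assms(2) by blast
  moreover from this have "b \<in> H" "b \<in> T" "(a, b) \<in> E"
    using T(2) region_subset assms(2) by (auto simp: induced_def)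
  ultimately have "b \<in> (H_star I S W U \<phi> - Z) \<inter> nbhs (induced E W) Z"
    using T(1) assms(3) likely_subset
    by (auto simp: nbhs_def nbh_def induced_def intro!: bexI[of _ a])
  then show ?thesis by blast
qed

end


section \<open>The cost of a round\<close>

lemma set_play: "set us \<subseteq> set (play I \<psi> t us)"
proof (induction t arbitrary: us)
  case (Choose v k)
  then show ?case by (fastforce simp del: set_append simp: set_append[of us "[v]"])
qed simp

context round_start
begin

text \<open>The nodes \<open>Z\<close> chosen by a policy all of whose observations agree with the prediction that
  exactly the nodes of \<^term>\<open>U \<union> H\<close> are active.\<close>

definition predicted_path :: "'a set \<Rightarrow> bool" where
  "predicted_path Z \<longleftrightarrow> r \<in> Z \<and> Z \<inter> (U \<union> H) \<subseteq> component (induced E (Z \<inter> (U \<union> H))) r \<and>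
     Z \<subseteq> nbhs E (Z \<inter> (U \<union> H))"

lemma predicted_state:
  assumes "\<psi> \<in> Psi_pred I W U \<phi> (Z \<inter> H)" "u \<in> nbhs E (Z \<inter> (U \<union> H))"
  shows "\<psi> u \<longleftrightarrow> u \<in> U \<union> H"
proof -
  obtain x where "x \<in> Z \<inter> (U \<union> H)" "u \<in> nbh E x" using assms(2) by (auto simp: nbhs_def)
  then show ?thesis by (intro Psi_pred_nbh[OF assms(1), of x]) auto
qed

lemma predicted_active:
  assumes "predicted_path Z" "\<psi> \<in> Psi_pred I W U \<phi> (Z \<inter> H)"
  shows "Z \<inter> active \<psi> = Z \<inter> (U \<union> H)"
  using assms predicted_state[OF assms(2)] by (auto simp: predicted_path_def active_def)

lemma predicted_observed:
  assumes "predicted_path Z" "\<psi> \<in> Psi_pred I W U \<phi> (Z \<inter> H)"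
  shows "observed I \<psi> Z =
    (\<lambda>u. if u \<in> nbhs E (Z \<inter> (U \<union> H)) then Some (u \<in> U \<union> H) else None)"
  using assms(1) predicted_state[OF assms(2)]
  unfolding observed_def predicted_active[OF assms] predicted_path_def
  by (intro ext) auto

lemma predicted_path_insert:
  assumes "predicted_path Z" "v \<in> nbhs E (Z \<inter> (U \<union> H))"
  shows "predicted_path (insert v Z)"
proof (cases "v \<in> U \<union> H \<and> v \<notin> Z")
  case True
  then have eq: "insert v Z \<inter> (U \<union> H) = insert v (Z \<inter> (U \<union> H))" by auto
  obtain x where x: "x \<in> Z \<inter> (U \<union> H)" "(x, v) \<in> E"
    using assms(2) True by (auto simp: nbhs_def nbh_def)
  have "insert v (Z \<inter> (U \<union> H)) \<subseteq> component (induced E (insert v (Z \<inter> (U \<union> H)))) r"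
    using assms(1) x by (intro component_insert) (auto simp: predicted_path_def)
  moreover have "insert v Z \<subseteq> nbhs E (insert v (Z \<inter> (U \<union> H)))"
    using assms by (auto simp: predicted_path_def nbhs_def nbh_def)
  ultimately show ?thesis using assms(1) unfolding predicted_path_def eq by blast
next
  case False
  then have "insert v Z \<inter> (U \<union> H) = Z \<inter> (U \<union> H)" by auto
  then show ?thesis using assms unfolding predicted_path_def by auto
qed

text \<open>Each \<open>\<psi>\<close> is consistent with what is seen under it, so a justified stop
  yields a solution for \<open>\<psi>\<close> itself; along a predicted path that solution is
  \<open>Z \<inter> (U \<union> H)\<close>.\<close>

lemma solution_f_plt:
  assumes "predicted_path Z"
    and "\<And>\<psi>. \<psi> \<in> Psi_pred I W U \<phi> (Z \<inter> H) \<Longrightarrow> determined I (observed I \<psi> Z) Z"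
  shows "f_plt I W U \<phi> (Z \<inter> (U \<union> H)) = real (card (W - dom \<phi>))"
  unfolding f_plt_full_iff
proof (intro ballI impI)
  fix v \<psi>
  assume v: "v \<in> W - dom \<phi>" "same_comp I \<psi> v r"
    and "\<psi> \<in> Psi_pred I W U \<phi> (Z \<inter> (U \<union> H) \<inter> H)"
  moreover have "Z \<inter> (U \<union> H) \<inter> H = Z \<inter> H" by auto
  ultimately have \<psi>: "\<psi> \<in> Psi_pred I W U \<phi> (Z \<inter> H)" by simp
  have "\<psi> \<in> Psi I (observed I \<psi> Z)"
    using \<psi> by (auto simp: Psi_pred_def Psi_iff extends_def observed_def split: if_splits)
  then have "solution I \<psi> {v \<in> Z. observed I \<psi> Z v = Some True}"
    using assms(2)[OF \<psi>] by (simp add: determined_def)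
  moreover have "{v \<in> Z. observed I \<psi> Z v = Some True} = Z \<inter> (U \<union> H)"
    unfolding predicted_active[OF assms(1) \<psi>, symmetric]
    by (auto simp: observed_def active_def)
  ultimately have "component (induced E (active \<psi>)) r \<subseteq> nbhs E (Z \<inter> (U \<union> H))"
    by (simp add: solution_def)
  then have "v \<in> nbhs E (Z \<inter> (U \<union> H))" using v(2) by (auto simp: same_comp_root)
  moreover have "Z \<inter> (U \<union> H) \<subseteq> W" using chosen_subset likely_subset by auto
  ultimately show "v \<in> nbhs (induced E W) (Z \<inter> (U \<union> H))"
    using v(1) by (simp add: nbhs_induced)
qed

text \<open>Following the policy along the predicted observations, we stop as soon as the prediction has
  lost half of its probability; up to that point all nodes of the path are paid for with
  conditional probability at least one half.\<close>

lemma policy_path: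
  assumes "\<And>\<psi>. \<psi> \<in> Psi_pred I W U \<phi> (set us \<inter> H) \<Longrightarrow> legal I \<psi> t us"
    and "predicted_path (set us)"
    and "prob_of I \<phi> < 2 * sum p (Psi_pred I W U \<phi> (set us \<inter> H))"
  shows "\<exists>X Q. Q \<subseteq> Psi_pred I W U \<phi> (set us \<inter> H) \<and> prob_of I \<phi> \<le> 2 * sum p Q \<and>
    (\<forall>\<psi>\<in>Q. X \<subseteq> set (play I \<psi> t us)) \<and> predicted_path X \<and>
    (f_plt I W U \<phi> (X \<inter> (U \<union> H)) = real (card (W - dom \<phi>)) \<or>
     f_plr I W U \<phi> (X \<inter> (U \<union> H)) = 1/2)"
  using assms
proof (induction t arbitrary: us)
  case Stop
  have "f_plt I W U \<phi> (set us \<inter> (U \<union> H)) = real (card (W - dom \<phi>))"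
    using Stop by (intro solution_f_plt) auto
  then show ?case
    using Stop(2,3)
    by (intro exI[of _ "set us"] exI[of _ "Psi_pred I W U \<phi> (set us \<inter> H)"])
      auto
next
  case (Choose v k)
  let ?Q = "Psi_pred I W U \<phi> (set us \<inter> H)" and ?us = "us @ [v]"
  let ?Q' = "Psi_pred I W U \<phi> (set ?us \<inter> H)"
  have "?Q \<noteq> {}" using Choose(4) prob_of_pos[OF Psi_nonempty] by auto
  then obtain \<psi>0 where \<psi>0: "\<psi>0 \<in> ?Q" by blast
  have "v \<in> nbhs E (set us \<inter> (U \<union> H))"
    using Choose(2)[OF \<psi>0] predicted_active[OF Choose(3) \<psi>0] by simp
  from predicted_path_insert[OF Choose(3) this] have path: "predicted_path (set ?us)" by simp
  show ?case
  proof (cases "prob_of I \<phi> < 2 * sum p ?Q'")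
    \<comment> \<open>\<open>v\<close> is chosen before its neighborhood is seen. So all of
      \<open>?Q\<close>, still more than half of the mass, pays for \<open>v\<close>, although its
      prediction then leaves at most half. This is why \<open>X\<close> includes \<open>v\<close>
      while \<open>Q\<close> is the class before \<open>v\<close>.\<close>
    case False
    have "set ?us \<inter> (U \<union> H) \<inter> H = set ?us \<inter> H" by auto
    then have "f_plr I W U \<phi> (set ?us \<inter> (U \<union> H)) = 1/2"
      using False unfolding f_plr_half_iff by simp
    moreover have "set ?us \<subseteq> set (play I \<psi> (Choose v k) us)" for \<psi>
      using set_play[of ?us] by simp
    ultimately show ?thesis
      using path Choose(4) by (intro exI[of _ "set ?us"] exI[of _ ?Q]) auto
  next
    case True
    \<comment> \<open>All realizations that fit the prediction produce the same observations, so
      they continue in one common subtree \<open>k ob\<close>.\<close>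
    define ob where "ob = (\<lambda>u. if u \<in> nbhs E (set ?us \<inter> (U \<union> H)) then Some (u \<in> U \<union> H) else None)"
    have ob: "observed I \<psi> (set ?us) = ob" if "\<psi> \<in> ?Q'" for \<psi>
      unfolding ob_def by (rule predicted_observed[OF path that])
    have sub: "?Q' \<subseteq> ?Q" by (auto simp: Psi_pred_def)
    have leg: "legal I \<psi> (k ob) ?us" if "\<psi> \<in> ?Q'" for \<psi>
    proof -
      have "legal I \<psi> (Choose v k) us" using that sub by (intro Choose(2)) blast
      then show ?thesis using ob[OF that] by simp
    qed
    obtain X Q where XQ: "Q \<subseteq> ?Q'" "prob_of I \<phi> \<le> 2 * sum p Q"
      "\<forall>\<psi>\<in>Q. X \<subseteq> set (play I \<psi> (k ob) ?us)" "predicted_path X"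
      "f_plt I W U \<phi> (X \<inter> (U \<union> H)) = real (card (W - dom \<phi>)) \<or>
       f_plr I W U \<phi> (X \<inter> (U \<union> H)) = 1/2"
      using Choose(1)[OF rangeI leg path True] by blast
    have "play I \<psi> (Choose v k) us = play I \<psi> (k ob) ?us" if "\<psi> \<in> Q" for \<psi>
      using ob[of \<psi>] that XQ(1) by auto
    then show ?thesis
      using XQ sub by (intro exI[of _ X] exI[of _ Q]) auto
  qed
qed

lemma round_cost:
  assumes "steiner_approx \<alpha> S" "adaptive_policy I \<pi>"
  shows "prob_of I \<phi> * sum w (H_star I S W U \<phi>) \<le>
    2 * \<alpha> * (\<Sum>\<psi>\<in>Psi I \<phi>. p \<psi> * (policy_weight I \<pi> \<psi> - w r))"
proof -
  have \<alpha>: "0 \<le> \<alpha>" using steiner_approx_ge_1[OF assms(1)] by simp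
  define ob where "ob = (\<lambda>u. if u \<in> nbhs E {r} then Some (u \<in> U \<union> H) else None)"
  have rU: "{r} \<inter> (U \<union> H) = {r}" "{r} \<inter> H = {}" using root_chosen likely_disjoint by auto
  have path: "predicted_path {r}"
    unfolding predicted_path_def rU by (auto simp: component_refl nbhs_def nbh_def)
  \<comment> \<open>The compared policy is replayed from the root alone, whatever \<open>U\<close>
    is. Since \<open>r\<close> is not in \<open>H\<close>, no prediction has been tested yet and the
    full class is present.\<close>
  have pred: "Psi_pred I W U \<phi> ({r} \<inter> H) = Psi I \<phi>" by (auto simp: rU Psi_pred_def)
  have ob: "observed I \<psi> {r} = ob" if "\<psi> \<in> Psi I \<phi>" for \<psi>
    using predicted_observed[OF path, of \<psi>] that unfolding pred rU(1) ob_def by blast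
  have leg: "legal I \<psi> (\<pi> ob) [r]" if "\<psi> \<in> Psi I \<phi>" for \<psi>
    using assms(2) that ob[OF that] by (auto simp: adaptive_policy_def Psi_iff)
  obtain X Q where Q: "Q \<subseteq> Psi I \<phi>" "prob_of I \<phi> \<le> 2 * sum p Q"
    and play: "\<forall>\<psi>\<in>Q. X \<subseteq> set (play I \<psi> (\<pi> ob) [r])" and X: "predicted_path X"
    and full: "f_plt I W U \<phi> (X \<inter> (U \<union> H)) = real (card (W - dom \<phi>)) \<or>
     f_plr I W U \<phi> (X \<inter> (U \<union> H)) = 1/2"
    using policy_path[of "[r]" "\<pi> ob"] leg path prob_of_pos[OF Psi_nonempty]
    by (auto simp: pred prob_of_eq[symmetric])
  let ?Y = "X \<inter> (U \<union> H)"
  have Y: "r \<in> ?Y" "?Y \<subseteq> component (induced E ?Y) r"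
    using X root_chosen by (auto simp: predicted_path_def)
  have "?Y \<subseteq> R" using Y(2) by (intro connected_subset_region) auto
  from H_star_weight[OF assms(1) Y(1) this Y(2) full]
  have star: "sum w (H_star I S W U \<phi>) \<le> \<alpha> * sum w (?Y - U)" .
  have root_run: "r \<in> set (run I \<pi> \<psi>)" for \<psi>
    using set_play[of "[r]"] by (simp add: run_def)
  have excess: "policy_weight I \<pi> \<psi> - w r = sum w (set (run I \<pi> \<psi>) - {r})" for \<psi>
    using root_run by (simp add: policy_weight_def sum_diff1)
  have Y_le: "sum w (?Y - U) \<le> policy_weight I \<pi> \<psi> - w r" if "\<psi> \<in> Q" for \<psi>
    unfolding excess
  proof (rule sum_mono2)
    show "?Y - U \<subseteq> set (run I \<pi> \<psi>) - {r}"
      using that play ob[of \<psi>] Q(1) root_chosen by (auto simp: run_def)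
  qed (auto simp: w_nonneg)
  \<comment> \<open>The factor 2 of the theorem: \<open>Q\<close> holds at least half of the mass,
    and each of its members pays for \<open>?Y - U\<close>.\<close>
  have "prob_of I \<phi> * sum w (H_star I S W U \<phi>) \<le> 2 * sum p Q * (\<alpha> * sum w (?Y - U))"
    using Q(2) star by (intro mult_mono) (auto simp: sum_nonneg w_nonneg)
  also have "\<dots> = 2 * \<alpha> * (\<Sum>\<psi>\<in>Q. p \<psi> * sum w (?Y - U))"
    by (simp add: sum_distrib_right[symmetric])
  also have "\<dots> \<le> 2 * \<alpha> * (\<Sum>\<psi>\<in>Q. p \<psi> * (policy_weight I \<pi> \<psi> - w r))"
    using \<alpha> Y_le by (intro mult_left_mono sum_mono) auto
  also have "\<dots> \<le> 2 * \<alpha> * (\<Sum>\<psi>\<in>Psi I \<phi>. p \<psi> * (policy_weight I \<pi> \<psi> - w r))"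
    using \<alpha> Q(1) unfolding excess
    by (intro mult_left_mono sum_mono2 mult_nonneg_nonneg sum_nonneg) (auto simp: w_nonneg)
  finally show ?thesis .
qed

end


section \<open>The inner loop\<close>

text \<open>Here \<open>U\<close> and \<open>\<phi>\<close> belong to the beginning of the round, \<open>U'\<close> and \<open>\<phi>'\<close> to a later point in
  the round at which all predictions have been correct so far.\<close>

locale sweep_state = round_start I W U \<phi> + now: cds_state I W U' \<phi>'
  for I :: "('v::finite) rcds" and W U :: "'v set" and \<phi> :: "'v realization"
    and U' :: "'v set" and \<phi>' :: "'v realization" +
  fixes Hs :: "'v set"
  assumes chosen_mono: "U \<subseteq> U'"
    and Hs_likely: "Hs \<subseteq> H"
    and Psi_now: "Psi I \<phi>' \<subseteq> Psi_pred I W U \<phi> (U' \<inter> H)"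
    and new_likely: "U' \<subseteq> U \<union> H"
begin

lemma Psi_now_subset: "Psi I \<phi>' \<subseteq> Psi I \<phi>"
  using Psi_now by (auto simp: Psi_pred_def)

text \<open>Being possibly active does not yet mean being connected to the root. The undominated
  node \<open>b\<close> is therefore taken next to a dominated node \<open>a\<close>: the state of
  \<open>a\<close> is known, so the realization with \<open>b\<close> active has \<open>a\<close>
  active too and connects \<open>b\<close> to the root. Then full \<open>f_plt\<close> puts
  \<open>b\<close> next to \<open>T\<close>, which has been chosen.\<close>

lemma finish_dominated:
  assumes "Hs = H \<inter> T" "Hs \<subseteq> U'" "T \<subseteq> R" "f_plt I W U \<phi> T = real (card (W - dom \<phi>))"
  shows "prune I W \<phi>' \<subseteq> nbhs E U'"
proof (rule ccontr)
  let ?P = "{u \<in> W. \<exists>\<psi>\<in>Psi I \<phi>'. \<psi> u}"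
  assume "\<not> prune I W \<phi>' \<subseteq> nbhs E U'"
  then obtain v where v: "v \<in> component (induced E ?P) r" "v \<notin> nbhs E U'"
    by (auto simp: prune_def)
  have "r \<in> nbhs E U'" using now.root_chosen by (auto simp: nbhs_def nbh_def)
  from component_exit_edge[OF this v] obtain a b
    where ab: "a \<in> nbhs E U'" "b \<notin> nbhs E U'" "(a, b) \<in> E" "a \<in> ?P" "b \<in> ?P"
    by (auto simp: induced_def)
  then obtain \<psi> \<psi>a where \<psi>: "\<psi> \<in> Psi I \<phi>'" "\<psi> b" and \<psi>a: "\<psi>a \<in> Psi I \<phi>'" "\<psi>a a" by blast
  obtain s where "\<phi>' a = Some s" using ab now.nbhs_known by blast
  then have "\<psi> a" using Psi_state \<psi>(1) \<psi>a by metis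
  obtain x where x: "x \<in> U'" "a = x \<or> (x, a) \<in> E" using ab(1) by (auto simp: nbhs_def nbh_def)
  let ?C = "component (induced E (active \<psi>)) r"
  have act: "U' \<subseteq> active \<psi>" using now.Psi_chosen[OF \<psi>(1)] by (auto simp: active_def)
  from component_mono[OF induced_mono[OF act], of E r] have U': "U' \<subseteq> ?C"
    using now.chosen_connected by (rule subset_trans[rotated])
  have "a \<in> ?C"
  proof (cases "a = x")
    case False
    then have "(x, a) \<in> induced E (active \<psi>)"
      using x \<open>\<psi> a\<close> act by (auto simp: induced_def active_def)
    from component_step[OF _ this, of r] show ?thesis using x U' by blast
  qed (use x U' in auto)
  moreover have "(a, b) \<in> induced E (active \<psi>)"
    using ab \<open>\<psi> a\<close> \<psi> by (auto simp: induced_def active_def)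
  ultimately have "b \<in> ?C" by (rule component_step)
  then have "same_comp I \<psi> b r"
    using \<psi> root_active[OF \<psi>(1)] by (simp add: same_comp_root)
  moreover have "b \<in> W - dom \<phi>"
    using ab dom_subset nbhs_mono[OF chosen_mono, of E] by blast
  moreover have "\<psi> \<in> Psi_pred I W U \<phi> (T \<inter> H)"
    using \<psi>(1) Psi_now assms(1,2) by (auto simp: Psi_pred_def)
  ultimately have "b \<in> nbhs (induced E W) T" using assms(4) unfolding f_plt_full_iff by blast
  moreover have "T \<subseteq> U'" using assms region_subset chosen_mono by blast
  ultimately have "b \<in> nbhs E U'" by (auto simp: nbhs_def nbh_def induced_def)
  then show False using ab(2) by contradiction
qed

lemma finish_half:
  assumes "Hs = H \<inter> T" "Hs \<subseteq> U'" "f_plr I W U \<phi> T = 1/2"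
  shows "2 * prob_of I \<phi>' \<le> prob_of I \<phi>"
proof -
  have "Psi I \<phi>' \<subseteq> Psi_pred I W U \<phi> (T \<inter> H)"
    using Psi_now assms(1,2) by (auto simp: Psi_pred_def)
  then have "sum p (Psi I \<phi>') \<le> sum p (Psi_pred I W U \<phi> (T \<inter> H))" by (intro sum_mono2) auto
  then show ?thesis using assms(3) unfolding f_plr_half_iff by (simp add: prob_of_eq)
qed

lemma sweep_complete:
  assumes "steiner_approx \<alpha> S" "Hs = H_star I S W U \<phi>" "Hs \<subseteq> U'"
  shows "prune I W \<phi>' \<subseteq> nbhs E U' \<or> 2 * prob_of I \<phi>' \<le> prob_of I \<phi>"
proof -
  obtain T where T: "H_star I S W U \<phi> = H \<inter> T" "T \<subseteq> R"
    "f_plt I W U \<phi> T = real (card (W - dom \<phi>)) \<or> f_plr I W U \<phi> T = 1/2"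
    using H_star_tree[OF assms(1)] by blast
  from T(3) show ?thesis
  proof
    assume "f_plt I W U \<phi> T = real (card (W - dom \<phi>))"
    then show ?thesis using finish_dominated[of T] T assms by simp
  next
    assume "f_plr I W U \<phi> T = 1/2"
    then show ?thesis using finish_half[of T] T assms by simp
  qed
qed

end

text \<open>Choosing a node partitions the class into the fibers of \<open>reveal\<close>. Costs are
  summed and subtrees are glued along this partition.\<close>

lemma (in rcds_instance) Psi_reveal:
  assumes "\<psi> \<in> Psi I \<phi>"
  shows "Psi I (reveal I \<psi> W v \<phi>) = {\<psi>' \<in> Psi I \<phi>. reveal I \<psi>' W v \<phi> = reveal I \<psi> W v \<phi>}"
proof -
  let ?N = "nbh (induced E W) v - dom \<phi>"
  have 1: "reveal I \<psi>' W v \<phi> = reveal I \<psi> W v \<phi> \<longleftrightarrow> (\<forall>u\<in>?N. \<psi>' u = \<psi> u)" for \<psi>'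
    unfolding reveal_def fun_eq_iff by (intro iffI ballI allI) (auto split: if_splits)
  have 2: "extends \<psi>' (reveal I \<psi> W v \<phi>) \<longleftrightarrow> extends \<psi>' \<phi> \<and> (\<forall>u\<in>?N. \<psi>' u = \<psi> u)" for \<psi>'
  proof
    assume *: "extends \<psi>' (reveal I \<psi> W v \<phi>)"
    have ext: "\<psi>' u = s" if "reveal I \<psi> W v \<phi> u = Some s" for u s
      using * bspec[OF *[unfolded extends_def], of u] that by auto
    have "\<phi> u = Some (\<psi>' u)" if "u \<in> dom \<phi>" for u
      using that ext[of u] by (auto simp: reveal_def)
    moreover have "\<psi>' u = \<psi> u" if "u \<in> ?N" for u
      using that ext[of u] by (auto simp: reveal_def)
    ultimately show "extends \<psi>' \<phi> \<and> (\<forall>u\<in>?N. \<psi>' u = \<psi> u)" unfolding extends_def by blast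
  next
    assume "extends \<psi>' \<phi> \<and> (\<forall>u\<in>?N. \<psi>' u = \<psi> u)"
    then show "extends \<psi>' (reveal I \<psi> W v \<phi>)"
      by (auto simp: extends_def reveal_def dom_def)
  qed
  show ?thesis unfolding Psi_def 1 2 by auto
qed

lemma (in rcds_instance) in_Psi_reveal: "\<psi> \<in> Psi I \<phi> \<Longrightarrow> \<psi> \<in> Psi I (reveal I \<psi> W v \<phi>)"
  by (simp add: Psi_reveal)

section \<open>One choice in the inner loop\<close>

context sweep_state
begin

text \<open>The next node is likely and adjacent to a chosen node around which the prediction is
  already confirmed, so it is known to be active. The algorithm thus never buys an inactive
  node.\<close>

lemma next_active:
  assumes "v \<in> (Hs - U') \<inter> nbhs (induced E W) U'" "\<psi> \<in> Psi I \<phi>'"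
  shows "\<psi> v"
proof -
  obtain x where "x \<in> U'" "v \<in> nbh E x"
    using assms(1) by (auto simp: nbhs_def nbh_def induced_def)
  moreover have "v \<in> H" using assms(1) Hs_likely by blast
  ultimately show ?thesis
    using Psi_pred_nbh[of \<psi> "U' \<inter> H" x v] assms(2) Psi_now new_likely by blast
qed

lemma cds_state_next:
  assumes v: "v \<in> (Hs - U') \<inter> nbhs (induced E W) U'" and \<psi>: "\<psi> \<in> Psi I \<phi>'"
  shows "cds_state I W (insert v U') (reveal I \<psi> W v \<phi>')"
proof -
  let ?\<phi> = "reveal I \<psi> W v \<phi>'"
  have vW: "v \<in> W" using v Hs_likely likely_subset by blast
  have sub: "Psi I ?\<phi> \<subseteq> Psi I \<phi>'" using Psi_reveal[OF \<psi>] by blast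
  have dom: "dom ?\<phi> = dom \<phi>' \<union> (nbh E v \<inter> W)"
    using nbh_induced[OF vW, of E] by (auto simp: reveal_def dom_def)
  have known: "?\<phi> u = Some (\<psi> u)" if "u \<in> dom ?\<phi>" for u
    using in_Psi_reveal[OF \<psi>, of W v] that by (auto simp: Psi_def extends_def)
  obtain x where x: "x \<in> U'" "(x, v) \<in> E"
    using v by (auto simp: nbhs_def nbh_def induced_def)
  have nb: "nbhs E (insert v U') = nbh E v \<union> nbhs E U'" by (auto simp: nbhs_def)
  show ?thesis
  proof unfold_locales
    show "r \<in> insert v U'" using now.root_chosen by blast
    show "insert v U' \<subseteq> W" using now.chosen_subset vW by blast
    show "insert v U' \<subseteq> component (induced E (insert v U')) r"
      by (rule component_insert[OF now.chosen_connected x])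
    show "dom ?\<phi> \<subseteq> nbhs E (insert v U')" using now.dom_subset unfolding dom nb by blast
    show "nbhs E (insert v U') \<inter> W \<subseteq> dom ?\<phi>" using now.nbhs_known unfolding dom nb by blast
    show "Psi I ?\<phi> \<noteq> {}" using in_Psi_reveal[OF \<psi>] by blast
  next
    fix u assume u: "u \<in> insert v U'"
    then have "\<psi> u" using next_active[OF v \<psi>] now.Psi_chosen[OF \<psi>] by blast
    moreover have "u \<in> dom ?\<phi>" using u vW now.chosen_active unfolding dom by (auto simp: nbh_def)
    ultimately show "?\<phi> u = Some True" using known by simp
  next
    fix \<psi>' x u assume "\<psi>' \<in> Psi I ?\<phi>" "x \<in> W" "(x, u) \<in> E" "u \<notin> W"
    then show "\<not> \<psi>' u" using now.boundary sub by blast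
  qed
qed

text \<open>A decision tree branches on observations, the algorithm on \<open>reveal\<close>; both
  separate the same realizations, so one can be translated into the other.\<close>

lemma observed_next_iff:
  assumes v: "v \<in> (Hs - U') \<inter> nbhs (induced E W) U'"
    and \<psi>: "\<psi> \<in> Psi I \<phi>'" "\<psi>' \<in> Psi I \<phi>'"
  shows "observed I \<psi>' (insert v U') = observed I \<psi> (insert v U') \<longleftrightarrow>
    reveal I \<psi>' W v \<phi>' = reveal I \<psi> W v \<phi>'"
proof
  assume "reveal I \<psi>' W v \<phi>' = reveal I \<psi> W v \<phi>'"
  then have "\<psi>' \<in> Psi I (reveal I \<psi> W v \<phi>')" using Psi_reveal[OF \<psi>(1)] \<psi>(2) by blast
  then show "observed I \<psi>' (insert v U') = observed I \<psi> (insert v U')"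
    using cds_state.observed_chosen[OF cds_state_next[OF v \<psi>(1)]] in_Psi_reveal[OF \<psi>(1)] by simp
next
  assume *: "observed I \<psi>' (insert v U') = observed I \<psi> (insert v U')"
  have ob: "observed I \<psi>'' (insert v U') u = Some (\<psi>'' u)"
    if "\<psi>'' \<in> Psi I \<phi>'" "u \<in> nbh E v" for \<psi>'' u
    using that next_active[OF v that(1)] by (auto simp: observed_def nbhs_def active_def)
  have "\<psi>' u = \<psi> u" if "u \<in> nbh (induced E W) v" for u
  proof -
    have "u \<in> nbh E v" using that by (auto simp: nbh_def induced_def)
    then show ?thesis using ob \<psi> * by (metis option.inject)
  qed
  then show "reveal I \<psi>' W v \<phi>' = reveal I \<psi> W v \<phi>'"
    by (intro ext) (simp add: reveal_def)
qed

lemma match_next: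
  assumes v: "v \<in> (Hs - U') \<inter> nbhs (induced E W) U'" and \<psi>: "\<psi> \<in> Psi I \<phi>'"
    and match: "\<forall>u\<in>nbh (induced E W) v. reveal I \<psi> W v \<phi>' u = xi I W U \<phi> v u"
  shows "sweep_state I W U \<phi> (insert v U') (reveal I \<psi> W v \<phi>') Hs"
proof -
  let ?\<phi> = "reveal I \<psi> W v \<phi>'"
  interpret nxt: cds_state I W "insert v U'" ?\<phi> by (rule cds_state_next[OF v \<psi>])
  have "extends \<psi>' (xi I W U \<phi> v)" if "\<psi>' \<in> Psi I ?\<phi>" for \<psi>'
    unfolding extends_def
  proof
    fix u assume u: "u \<in> dom (xi I W U \<phi> v)"
    then have "u \<in> nbh (induced E W) v" by (auto simp: xi_def split: if_splits)
    then have *: "?\<phi> u = xi I W U \<phi> v u" using match by blast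
    with u have "u \<in> dom ?\<phi>" by auto
    then show "xi I W U \<phi> v u = Some (\<psi>' u)"
      using * that by (simp add: Psi_def extends_def)
  qed
  then have "Psi I ?\<phi> \<subseteq> Psi_pred I W U \<phi> (insert v U' \<inter> H)"
    using Psi_reveal[OF \<psi>] Psi_now by (auto simp: Psi_pred_def)
  then show ?thesis
    using chosen_mono Hs_likely new_likely v by unfold_locales auto
qed

text \<open>The prediction is a majority vote at the start of the round, so the deviating node
  \<open>u\<close> shows a state of conditional probability at most 1/2: active outside
  \<open>H\<close> or inactive inside. It cannot lie in \<open>U\<close>, whose nodes are known to
  be active.\<close>

lemma mismatch_half:
  assumes v: "v \<in> (Hs - U') \<inter> nbhs (induced E W) U'" and \<psi>: "\<psi> \<in> Psi I \<phi>'"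
    and mismatch: "\<exists>u\<in>nbh (induced E W) v. reveal I \<psi> W v \<phi>' u \<noteq> xi I W U \<phi> v u"
  shows "2 * prob_of I (reveal I \<psi> W v \<phi>') \<le> prob_of I \<phi>"
proof -
  let ?\<phi> = "reveal I \<psi> W v \<phi>'"
  obtain u where u: "u \<in> nbh (induced E W) v" "?\<phi> u \<noteq> xi I W U \<phi> v u" using mismatch by blast
  have \<psi>': "\<psi> \<in> Psi I ?\<phi>" by (rule in_Psi_reveal[OF \<psi>])
  have sub: "Psi I ?\<phi> \<subseteq> Psi I \<phi>" using Psi_reveal[OF \<psi>] Psi_now_subset by blast
  have vW: "v \<in> W" using v Hs_likely likely_subset by blast
  then have uW: "u \<in> W" using u(1) nbh_induced by fast
  obtain s where s: "?\<phi> u = Some s" using u(1) by (cases "u \<in> dom \<phi>'") (auto simp: reveal_def)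
  then have su: "s \<noteq> (u \<in> U \<union> H)" using u by (simp add: xi_def)
  have all: "\<psi>'' u = s" if "\<psi>'' \<in> Psi I ?\<phi>" for \<psi>'' using Psi_state[OF that s] .
  have uU: "u \<notin> U" using su all[OF \<psi>'] Psi_chosen sub \<psi>' by blast
  let ?A = "{\<psi> \<in> Psi I \<phi>. \<psi> u}"
  have tot: "prob_of I \<phi> = sum p ?A + sum p (Psi I \<phi> - ?A)"
    unfolding prob_of_eq by (subst sum.subset_diff[of ?A]) auto
  show ?thesis
  proof (cases s)
    case True
    then have "sum p (Psi I ?\<phi>) \<le> sum p ?A" using sub all by (intro sum_mono2) auto
    moreover have "2 * sum p ?A \<le> prob_of I \<phi>" using su True uU uW likely_iff[of u] by auto
    ultimately show ?thesis by (simp add: prob_of_eq[of ?\<phi>])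
  next
    case False
    then have "sum p (Psi I ?\<phi>) \<le> sum p (Psi I \<phi> - ?A)" using sub all by (intro sum_mono2) auto
    moreover have "prob_of I \<phi> < 2 * sum p ?A" using su False uU likely_iff[of u] by auto
    ultimately show ?thesis using tot by (simp add: prob_of_eq[of ?\<phi>])
  qed
qed

end

lemma (in round_start) sweep_start:
  "sweep_state I W U \<phi> U \<phi> (H_star I S W U \<phi>)"
proof unfold_locales
  show "Psi I \<phi> \<subseteq> Psi_pred I W U \<phi> (U \<inter> H)" using likely_disjoint by (auto simp: Psi_pred_def)
qed (auto simp: H_star_subset)


section \<open>Runs of the algorithm\<close>

lemma play_append: "\<exists>vs. play I \<psi> t us = us @ vs"
proof (induction t arbitrary: us)
  case (Choose v k)
  obtain vs where "play I \<psi> (k (observed I \<psi> (set (us @ [v])))) (us @ [v]) = (us @ [v]) @ vs"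
    using Choose by blast
  then show ?case by simp
qed simp

lemma play_Choose_append: "\<exists>vs. play I \<psi> (Choose v k) us = us @ v # vs"
  using play_append[of I \<psi> "k (observed I \<psi> (set (us @ [v])))" "us @ [v]"] by simp

lemma sweep_append: "sweep I \<psi> W Hs x us \<phi> us' \<phi>' \<Longrightarrow> \<exists>vs. us' = us @ vs"
  by (induction rule: sweep.induct) auto

lemma exec_append: "exec I S \<psi> W us \<phi> res \<Longrightarrow> \<exists>vs. res = us @ vs"
proof (induction rule: exec.induct)
  case (round W us \<phi> us' \<phi>' res)
  then show ?case using sweep_append by fastforce
qed simp

text \<open>Inside a round, \<open>H_star\<close> and the prediction stay frozen. Hence the data
  \<open>U\<close>, \<open>\<phi>0\<close> from its beginning are kept apart from the current
  \<open>us\<close> and \<open>\<phi>\<close>.\<close>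

definition resume ::
  "'v rcds \<Rightarrow> 'v steiner_alg \<Rightarrow> 'v full \<Rightarrow> 'v set \<Rightarrow> 'v set \<Rightarrow> 'v realization \<Rightarrow>
   'v list \<Rightarrow> 'v realization \<Rightarrow> 'v list \<Rightarrow> bool" where
  "resume I S \<psi> W U \<phi>0 us \<phi> res \<longleftrightarrow>
     (\<exists>us' \<phi>'. sweep I \<psi> W (H_star I S W U \<phi>0) (xi I W U \<phi>0) us \<phi> us' \<phi>' \<and>
        exec I S \<psi> (prune I W \<phi>') us' \<phi>' res)"

definition matches ::
  "'v rcds \<Rightarrow> 'v set \<Rightarrow> 'v set \<Rightarrow> 'v realization \<Rightarrow> 'v \<Rightarrow> 'v realization \<Rightarrow> bool" where
  "matches I W U \<phi>0 v \<phi>' \<longleftrightarrow> (\<forall>u\<in>nbh (induced (edges I) W) v. \<phi>' u = xi I W U \<phi>0 v u)"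

definition resume_after ::
  "'v rcds \<Rightarrow> 'v steiner_alg \<Rightarrow> 'v full \<Rightarrow> 'v set \<Rightarrow> 'v set \<Rightarrow> 'v realization \<Rightarrow> 'v \<Rightarrow>
   'v list \<Rightarrow> 'v realization \<Rightarrow> 'v list \<Rightarrow> bool" where
  "resume_after I S \<psi> W U \<phi>0 v us \<phi>' res \<longleftrightarrow>
     (if matches I W U \<phi>0 v \<phi>' then resume I S \<psi> W U \<phi>0 us \<phi>' res
      else exec I S \<psi> (prune I W \<phi>') us \<phi>' res)"

lemma exec_iff:
  "exec I S \<psi> W us \<phi> res \<longleftrightarrow>
     (if W \<subseteq> nbhs (induced (edges I) W) (set us) then res = us
      else resume I S \<psi> W (set us) \<phi> us \<phi> res)"
  by (subst exec.simps) (auto simp: resume_def)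

lemma resume_finished:
  assumes "H_star I S W U \<phi>0 \<subseteq> set us"
  shows "resume I S \<psi> W U \<phi>0 us \<phi> res \<longleftrightarrow> exec I S \<psi> (prune I W \<phi>) us \<phi> res"
proof -
  have "sweep I \<psi> W (H_star I S W U \<phi>0) (xi I W U \<phi>0) us \<phi> us' \<phi>' \<longleftrightarrow> us' = us \<and> \<phi>' = \<phi>"
    for us' \<phi>'
    using assms by (subst sweep.simps) auto
  then show ?thesis by (simp add: resume_def)
qed

lemma resume_step:
  assumes "\<not> H_star I S W U \<phi>0 \<subseteq> set us"
  shows "resume I S \<psi> W U \<phi>0 us \<phi> res \<longleftrightarrow>
    (\<exists>v \<in> (H_star I S W U \<phi>0 - set us) \<inter> nbhs (induced (edges I) W) (set us).
       resume_after I S \<psi> W U \<phi>0 v (us @ [v]) (reveal I \<psi> W v \<phi>) res)"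
    (is "?l \<longleftrightarrow> ?r")
proof
  assume ?l
  then obtain us' \<phi>' where sw: "sweep I \<psi> W (H_star I S W U \<phi>0) (xi I W U \<phi>0) us \<phi> us' \<phi>'"
    and ex: "exec I S \<psi> (prune I W \<phi>') us' \<phi>' res" by (auto simp: resume_def)
  from sw show ?r
  proof cases
    case finished
    then show ?thesis using assms by blast
  next
    case (mismatch v)
    then have "\<not> matches I W U \<phi>0 v (reveal I \<psi> W v \<phi>)" by (auto simp: matches_def)
    then show ?thesis
      using mismatch ex unfolding resume_after_def by (intro bexI[of _ v]) auto
  next
    case (match v)
    then have "matches I W U \<phi>0 v (reveal I \<psi> W v \<phi>)" by (auto simp: matches_def)
    then show ?thesis
      using match ex unfolding resume_after_def resume_def by (intro bexI[of _ v]) auto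
  qed
next
  assume ?r
  then obtain v where v: "v \<in> (H_star I S W U \<phi>0 - set us) \<inter> nbhs (induced (edges I) W) (set us)"
    and af: "resume_after I S \<psi> W U \<phi>0 v (us @ [v]) (reveal I \<psi> W v \<phi>) res" by blast
  show ?l
  proof (cases "matches I W U \<phi>0 v (reveal I \<psi> W v \<phi>)")
    case True
    then obtain us' \<phi>' where
      "sweep I \<psi> W (H_star I S W U \<phi>0) (xi I W U \<phi>0) (us @ [v]) (reveal I \<psi> W v \<phi>) us' \<phi>'"
      and ex: "exec I S \<psi> (prune I W \<phi>') us' \<phi>' res"
      using af by (auto simp: resume_after_def resume_def)
    with True have "sweep I \<psi> W (H_star I S W U \<phi>0) (xi I W U \<phi>0) us \<phi> us' \<phi>'"
      by (intro sweep.match[OF v]) (auto simp: matches_def)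
    with ex show ?thesis unfolding resume_def by blast
  next
    case False
    then have "sweep I \<psi> W (H_star I S W U \<phi>0) (xi I W U \<phi>0) us \<phi> (us @ [v]) (reveal I \<psi> W v \<phi>)"
      by (intro sweep.mismatch[OF v]) (auto simp: matches_def)
    moreover have "exec I S \<psi> (prune I W (reveal I \<psi> W v \<phi>)) (us @ [v]) (reveal I \<psi> W v \<phi>) res"
      using af False by (simp add: resume_after_def)
    ultimately show ?thesis unfolding resume_def by blast
  qed
qed

lemma resume_after_append:
  "resume_after I S \<psi> W U \<phi>0 v us \<phi> res \<Longrightarrow> \<exists>vs. res = us @ vs"
  unfolding resume_after_def resume_def
  by (auto dest!: exec_append sweep_append split: if_splits)

text \<open>\<open>play\<close> only appends, so the first new entry of the run is the choice at the
  top of \<open>t\<close>. The order left open by the algorithm is thus fixed by the tree and not by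
  \<open>\<psi>\<close>.\<close>

lemma resume_play:
  assumes "\<not> H_star I S W U \<phi>0 \<subseteq> set us" "resume I S \<psi> W U \<phi>0 us \<phi> (play I \<psi> t us)"
  shows "\<exists>v k. t = Choose v k \<and>
    v \<in> (H_star I S W U \<phi>0 - set us) \<inter> nbhs (induced (edges I) W) (set us) \<and>
    resume_after I S \<psi> W U \<phi>0 v (us @ [v]) (reveal I \<psi> W v \<phi>)
      (play I \<psi> (k (observed I \<psi> (insert v (set us)))) (us @ [v]))"
proof -
  obtain v where v: "v \<in> (H_star I S W U \<phi>0 - set us) \<inter> nbhs (induced (edges I) W) (set us)"
    and af: "resume_after I S \<psi> W U \<phi>0 v (us @ [v]) (reveal I \<psi> W v \<phi>) (play I \<psi> t us)"
    using assms by (auto simp: resume_step)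
  obtain vs where vs: "play I \<psi> t us = us @ v # vs" using resume_after_append[OF af] by auto
  show ?thesis
  proof (cases t)
    case Stop
    then show ?thesis using vs by simp
  next
    case (Choose v' k)
    then have "v' = v" using vs play_Choose_append[of I \<psi> v' k us] by auto
    then show ?thesis using Choose v af by auto
  qed
qed

lemma (in cds_state) dominated_iff: "W \<subseteq> nbhs (induced E W) U \<longleftrightarrow> W \<subseteq> nbhs E U"
  using nbhs_induced[OF chosen_subset, of E] by blast

text \<open>Termination is built into this rule: a round that chooses no node ends with a graph
  dominated by the chosen nodes.\<close>

lemma (in rcds_instance) algorithm_induct [consumes 2, case_names halt round finish step]:
  assumes approx: "steiner_approx \<alpha> S"
    and start: "round_start I W (set us) \<phi>"
    and halt: "\<And>W us \<phi>. round_start I W (set us) \<phi> \<Longrightarrow> W \<subseteq> nbhs E (set us) \<Longrightarrow> P W us \<phi>"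
    and round: "\<And>W us \<phi>. round_start I W (set us) \<phi> \<Longrightarrow> \<not> W \<subseteq> nbhs E (set us) \<Longrightarrow>
      Q W (set us) \<phi> us \<phi> \<Longrightarrow> P W us \<phi>"
    and finish: "\<And>W U \<phi>0 us \<phi>. sweep_state I W U \<phi>0 (set us) \<phi> (H_star I S W U \<phi>0) \<Longrightarrow>
      H_star I S W U \<phi>0 \<subseteq> set us \<Longrightarrow>
      prune I W \<phi> \<subseteq> nbhs E (set us) \<or> 2 * prob_of I \<phi> \<le> prob_of I \<phi>0 \<Longrightarrow>
      P (prune I W \<phi>) us \<phi> \<Longrightarrow> Q W U \<phi>0 us \<phi>"
    and step: "\<And>W U \<phi>0 us \<phi>. sweep_state I W U \<phi>0 (set us) \<phi> (H_star I S W U \<phi>0) \<Longrightarrow>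
      \<not> H_star I S W U \<phi>0 \<subseteq> set us \<Longrightarrow>
      (\<And>v \<psi>. v \<in> (H_star I S W U \<phi>0 - set us) \<inter> nbhs (induced E W) (set us) \<Longrightarrow> \<psi> \<in> Psi I \<phi> \<Longrightarrow>
        matches I W U \<phi>0 v (reveal I \<psi> W v \<phi>) \<Longrightarrow>
        Q W U \<phi>0 (us @ [v]) (reveal I \<psi> W v \<phi>)) \<Longrightarrow>
      (\<And>v \<psi>. v \<in> (H_star I S W U \<phi>0 - set us) \<inter> nbhs (induced E W) (set us) \<Longrightarrow> \<psi> \<in> Psi I \<phi> \<Longrightarrow>
        \<not> matches I W U \<phi>0 v (reveal I \<psi> W v \<phi>) \<Longrightarrow>
        2 * prob_of I (reveal I \<psi> W v \<phi>) \<le> prob_of I \<phi>0 \<and>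
        P (prune I W (reveal I \<psi> W v \<phi>)) (us @ [v]) (reveal I \<psi> W v \<phi>)) \<Longrightarrow>
      Q W U \<phi>0 us \<phi>"
  shows "P W us \<phi>"
proof -
  \<comment> \<open>Simultaneous induction on the number of unchosen nodes. Only a choice decreases
    it; starting or finishing a round does not. So for a given \<open>n\<close> the order is:
    \<open>Q\<close> before a choice, then \<open>P\<close>, then \<open>Q\<close> at the end of a
    round.\<close>
  have "(\<forall>W us \<phi>. card (- set us) = n \<longrightarrow> round_start I W (set us) \<phi> \<longrightarrow> P W us \<phi>) \<and>
    (\<forall>W U \<phi>0 us \<phi>. card (- set us) = n \<longrightarrow>
       sweep_state I W U \<phi>0 (set us) \<phi> (H_star I S W U \<phi>0) \<longrightarrow> Q W U \<phi>0 us \<phi>)" for n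
  proof (induction n rule: less_induct)
    case (less n)
    have smaller: "card (- set (us @ [v])) < card (- set us)" if "v \<notin> set us" for v and us :: "'v list"
      using that by (intro psubset_card_mono) auto
    have Q_step: "Q W U \<phi>0 us \<phi>"
      if n: "card (- set us) = n"
        and sw: "sweep_state I W U \<phi>0 (set us) \<phi> (H_star I S W U \<phi>0)"
        and open_: "\<not> H_star I S W U \<phi>0 \<subseteq> set us" for W U \<phi>0 us \<phi>
    proof (rule step[OF sw open_])
      interpret sweep_state I W U \<phi>0 "set us" \<phi> "H_star I S W U \<phi>0" by (rule sw)
      fix v \<psi>
      assume v: "v \<in> (H_star I S W U \<phi>0 - set us) \<inter> nbhs (induced E W) (set us)"
        and \<psi>: "\<psi> \<in> Psi I \<phi>"
      have c: "card (- set (us @ [v])) < n" using smaller[of v us] v n by blast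
      have s: "set (us @ [v]) = insert v (set us)" by simp
      {
        assume "matches I W U \<phi>0 v (reveal I \<psi> W v \<phi>)"
        from match_next[OF v \<psi> this[unfolded matches_def]]
        have "sweep_state I W U \<phi>0 (set (us @ [v])) (reveal I \<psi> W v \<phi>) (H_star I S W U \<phi>0)"
          by simp
        then show "Q W U \<phi>0 (us @ [v]) (reveal I \<psi> W v \<phi>)" using less.IH[OF c] by blast
      next
        assume "\<not> matches I W U \<phi>0 v (reveal I \<psi> W v \<phi>)"
        then have "2 * prob_of I (reveal I \<psi> W v \<phi>) \<le> prob_of I \<phi>0"
          by (intro mismatch_half[OF v \<psi>]) (auto simp: matches_def)
        moreover have "round_start I (prune I W (reveal I \<psi> W v \<phi>)) (set (us @ [v])) (reveal I \<psi> W v \<phi>)"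
          unfolding s by (rule cds_state.round_start_prune[OF cds_state_next[OF v \<psi>]])
        ultimately show "2 * prob_of I (reveal I \<psi> W v \<phi>) \<le> prob_of I \<phi>0 \<and>
          P (prune I W (reveal I \<psi> W v \<phi>)) (us @ [v]) (reveal I \<psi> W v \<phi>)"
          using less.IH[OF c] by blast
      }
    qed
    have P_all: "P W us \<phi>" if n: "card (- set us) = n" and rs: "round_start I W (set us) \<phi>" for W us \<phi>
    proof (cases "W \<subseteq> nbhs E (set us)")
      case True
      then show ?thesis by (rule halt[OF rs])
    next
      case False
      interpret round_start I W "set us" \<phi> by (rule rs)
      interpret sw: sweep_state I W "set us" \<phi> "set us" \<phi> "H_star I S W (set us) \<phi>"
        by (rule sweep_start)
      have "Q W (set us) \<phi> us \<phi>"
      proof (cases "H_star I S W (set us) \<phi> \<subseteq> set us")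
        case True
        \<comment> \<open>With nothing to choose, \<open>\<phi>\<close> is unchanged and its
          positive probability cannot have halved. So \<open>sweep_complete\<close> leaves only
          domination, and \<open>halt\<close> applies without recursion.\<close>
        then have dom: "prune I W \<phi> \<subseteq> nbhs E (set us)"
          using sw.sweep_complete[OF approx refl] prob_of_pos[OF Psi_nonempty] by auto
        then show ?thesis
          using finish[OF sweep_start True] halt[OF round_start_prune dom] by blast
      next
        case False
        then show ?thesis by (rule Q_step[OF n sweep_start])
      qed
      then show ?thesis by (rule round[OF rs False])
    qed
    have "Q W U \<phi>0 us \<phi>"
      if n: "card (- set us) = n"
        and sw: "sweep_state I W U \<phi>0 (set us) \<phi> (H_star I S W U \<phi>0)" for W U \<phi>0 us \<phi>
    proof (cases "H_star I S W U \<phi>0 \<subseteq> set us")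
      case True
      interpret sweep_state I W U \<phi>0 "set us" \<phi> "H_star I S W U \<phi>0" by (rule sw)
      show ?thesis
        by (rule finish[OF sw True sweep_complete[OF approx refl True]
              P_all[OF n now.round_start_prune]])
    next
      case False
      then show ?thesis by (rule Q_step[OF n sw])
    qed
    then show ?case using P_all by blast
  qed
  then show ?thesis using start by blast
qed

section \<open>Legality and existence of the policy\<close>

context rcds_instance
begin

text \<open>The tree is known only through its runs. Since every choice is appended, a run reveals
  along \<open>\<psi>\<close> what the tree chooses and where it stops, which is all that
  \<open>legal\<close> inspects.\<close>

lemma legal_algorithm:
  assumes approx: "steiner_approx \<alpha> S" and rs: "round_start I W (set us) \<phi>"
    and \<psi>: "\<psi> \<in> Psi I \<phi>" "exec I S \<psi> W us \<phi> (play I \<psi> t us)"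
  shows "legal I \<psi> t us"
proof -
  define Q where "Q W U \<phi>0 us \<phi> \<longleftrightarrow> (\<forall>\<psi>\<in>Psi I \<phi>. \<forall>t.
      resume I S \<psi> W U \<phi>0 us \<phi> (play I \<psi> t us) \<longrightarrow> legal I \<psi> t us)" for W U \<phi>0 us \<phi>
  from approx rs have "\<forall>\<psi>\<in>Psi I \<phi>. \<forall>t. exec I S \<psi> W us \<phi> (play I \<psi> t us) \<longrightarrow> legal I \<psi> t us"
  proof (induction rule: algorithm_induct[where Q = Q])
    case (halt W us \<phi>)
    interpret round_start I W "set us" \<phi> by (rule halt)
    show ?case
    proof (intro ballI allI impI)
      fix \<psi> t assume \<psi>: "\<psi> \<in> Psi I \<phi>" "exec I S \<psi> W us \<phi> (play I \<psi> t us)"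
      then have "play I \<psi> t us = us" using halt(2) by (simp add: exec_iff dominated_iff)
      then have "t = Stop"
      proof (cases t)
        case (Choose v k)
        then show ?thesis using play_Choose_append[of I \<psi> v k us] \<open>play I \<psi> t us = us\<close> by simp
      qed
      then show "legal I \<psi> t us" using determined_if_dominated[OF halt(2) \<psi>(1)] by simp
    qed
  next
    case (round W us \<phi>)
    interpret round_start I W "set us" \<phi> by (rule round)
    show ?case using round(2,3) by (simp add: exec_iff[of I S _ W] dominated_iff Q_def)
  next
    case (finish W U \<phi>0 us \<phi>)
    then show ?case by (simp add: Q_def resume_finished)
  next
    case (step W U \<phi>0 us \<phi>)
    interpret sweep_state I W U \<phi>0 "set us" \<phi> "H_star I S W U \<phi>0" by (rule step)
    show ?case
      unfolding Q_def
    proof (intro ballI allI impI)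
      fix \<psi> t assume \<psi>: "\<psi> \<in> Psi I \<phi>" and res: "resume I S \<psi> W U \<phi>0 us \<phi> (play I \<psi> t us)"
      obtain v k where t: "t = Choose v k"
        and v: "v \<in> (H_star I S W U \<phi>0 - set us) \<inter> nbhs (induced E W) (set us)"
        and af: "resume_after I S \<psi> W U \<phi>0 v (us @ [v]) (reveal I \<psi> W v \<phi>)
          (play I \<psi> (k (observed I \<psi> (insert v (set us)))) (us @ [v]))"
        using resume_play[OF step(2) res] by blast
      have "legal I \<psi> (k (observed I \<psi> (insert v (set us)))) (us @ [v])"
        using af step(3,4)[OF v \<psi>] in_Psi_reveal[OF \<psi>, of W v]
        by (auto simp: resume_after_def Q_def split: if_splits)
      moreover have "set us \<inter> active \<psi> = set us"
        using now.Psi_chosen[OF \<psi>] by (auto simp: active_def)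
      moreover have "v \<in> nbhs E (set us)" using v nbhs_induced[OF now.chosen_subset, of E] by blast
      ultimately show "legal I \<psi> t us" using t by simp
    qed
  qed
  then show ?thesis using \<psi> by blast
qed

lemma tree_algorithm:
  assumes approx: "steiner_approx \<alpha> S" and rs: "round_start I W (set us) \<phi>"
  shows "\<exists>t. \<forall>\<psi>\<in>Psi I \<phi>. exec I S \<psi> W us \<phi> (play I \<psi> t us)"
proof -
  define Q where "Q W U \<phi>0 us \<phi> \<longleftrightarrow> (\<exists>t. \<forall>\<psi>\<in>Psi I \<phi>.
      resume I S \<psi> W U \<phi>0 us \<phi> (play I \<psi> t us))" for W U \<phi>0 us \<phi>
  from approx rs show ?thesis
  proof (induction rule: algorithm_induct[where Q = Q])
    case (halt W us \<phi>)
    interpret round_start I W "set us" \<phi> by (rule halt)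
    show ?case using halt(2) by (intro exI[of _ Stop]) (simp add: exec_iff dominated_iff)
  next
    case (round W us \<phi>)
    interpret round_start I W "set us" \<phi> by (rule round)
    show ?case using round(2,3) by (simp add: exec_iff[of I S _ W] dominated_iff Q_def)
  next
    case (finish W U \<phi>0 us \<phi>)
    then show ?case by (simp add: Q_def resume_finished)
  next
    case (step W U \<phi>0 us \<phi>)
    interpret sweep_state I W U \<phi>0 "set us" \<phi> "H_star I S W U \<phi>0" by (rule step)
    obtain v where v: "v \<in> (H_star I S W U \<phi>0 - set us) \<inter> nbhs (induced E W) (set us)"
      using H_star_reachable[OF approx chosen_mono now.chosen_subset step(2)] by blast
    have "\<exists>t. \<forall>\<psi>'\<in>Psi I (reveal I \<psi> W v \<phi>).
        resume_after I S \<psi>' W U \<phi>0 v (us @ [v]) (reveal I \<psi> W v \<phi>) (play I \<psi>' t (us @ [v]))"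
      if \<psi>: "\<psi> \<in> Psi I \<phi>" for \<psi>
      using step(3,4)[OF v \<psi>] unfolding Q_def resume_after_def
      by (cases "matches I W U \<phi>0 v (reveal I \<psi> W v \<phi>)") simp_all
    then obtain F where F: "\<And>\<psi> \<psi>'. \<psi> \<in> Psi I \<phi> \<Longrightarrow> \<psi>' \<in> Psi I (reveal I \<psi> W v \<phi>) \<Longrightarrow>
        resume_after I S \<psi>' W U \<phi>0 v (us @ [v]) (reveal I \<psi> W v \<phi>) (play I \<psi>' (F \<psi>) (us @ [v]))"
      by metis
    \<comment> \<open>The subtrees \<open>F \<psi>\<close> were obtained per realization; a
      representative for each observation suffices, since equal observations mean equal
      \<open>reveal\<close>, and \<open>F \<psi>\<close> serves that whole class.\<close>
    define k where "k ob = F (SOME \<psi>. \<psi> \<in> Psi I \<phi> \<and> observed I \<psi> (insert v (set us)) = ob)" for ob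
    have "resume I S \<psi>' W U \<phi>0 us \<phi> (play I \<psi>' (Choose v k) us)" if \<psi>': "\<psi>' \<in> Psi I \<phi>" for \<psi>'
    proof -
      define \<psi> where "\<psi> = (SOME \<psi>. \<psi> \<in> Psi I \<phi> \<and>
        observed I \<psi> (insert v (set us)) = observed I \<psi>' (insert v (set us)))"
      have \<psi>: "\<psi> \<in> Psi I \<phi> \<and> observed I \<psi> (insert v (set us)) = observed I \<psi>' (insert v (set us))"
        unfolding \<psi>_def by (rule someI[of _ \<psi>']) (use \<psi>' in auto)
      then have eq: "reveal I \<psi> W v \<phi> = reveal I \<psi>' W v \<phi>"
        using observed_next_iff[OF v \<psi>'] by blast
      have "resume_after I S \<psi>' W U \<phi>0 v (us @ [v]) (reveal I \<psi>' W v \<phi>) (play I \<psi>' (F \<psi>) (us @ [v]))"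
        using F[of \<psi> \<psi>'] \<psi> in_Psi_reveal[OF \<psi>', of W v] unfolding eq by blast
      moreover have "k (observed I \<psi>' (set (us @ [v]))) = F \<psi>" by (simp add: k_def \<psi>_def)
      ultimately show ?thesis using v step(2) by (auto simp: resume_step)
    qed
    then show ?case unfolding Q_def by blast
  qed
qed

end


section \<open>The expected weight of the algorithm\<close>

text \<open>The bounds hold on average over realizations that are not told apart, not pointwise;
  this adds them up over the classes.\<close>

lemma sum_mono_fibers:
  fixes f g :: "'a \<Rightarrow> real"
  assumes "finite A"
    and "\<And>a. a \<in> A \<Longrightarrow> sum f {b \<in> A. h b = h a} \<le> sum g {b \<in> A. h b = h a}"
  shows "sum f A \<le> sum g A"
proof -
  have "sum f A = (\<Sum>y\<in>h ` A. sum f {b \<in> A. h b = y})" by (rule sum.image_gen[OF assms(1)])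
  also have "\<dots> \<le> (\<Sum>y\<in>h ` A. sum g {b \<in> A. h b = y})"
    by (rule sum_mono) (use assms(2) in blast)
  also have "\<dots> = sum g A" by (rule sum.image_gen[OF assms(1), symmetric])
  finally show ?thesis .
qed

context rcds_instance
begin

definition excess :: "'v policy \<Rightarrow> 'v full \<Rightarrow> real" where
  "excess \<pi> \<psi> = policy_weight I \<pi> \<psi> - w r"

lemma excess_nonneg: "0 \<le> excess \<pi> \<psi>"
proof -
  have "r \<in> set (run I \<pi> \<psi>)" using set_play[of "[r]"] by (simp add: run_def)
  then have "w r \<le> sum w (set (run I \<pi> \<psi>))" by (intro member_le_sum) (auto simp: w_nonneg)
  then show ?thesis by (simp add: excess_def policy_weight_def)
qed

lemma log_halved:
  assumes "Psi I \<phi>' \<noteq> {}" "2 * prob_of I \<phi>' \<le> prob_of I \<phi>"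
  shows "1 + log 2 (prob_of I \<phi>' / delta I) \<le> log 2 (prob_of I \<phi> / delta I)"
proof -
  have pos: "0 < prob_of I \<phi>'" by (rule prob_of_pos[OF assms(1)])
  have "1 + log 2 (prob_of I \<phi>' / delta I) = log 2 (2 * prob_of I \<phi>' / delta I)"
    using pos delta_pos by (simp add: log_mult log_divide)
  also have "\<dots> \<le> log 2 (prob_of I \<phi> / delta I)"
    using pos delta_pos assms(2) by (simp add: divide_right_mono)
  finally show ?thesis .
qed

lemma log_prob_nonneg:
  assumes "Psi I \<phi> \<noteq> {}"
  shows "0 \<le> log 2 (prob_of I \<phi> / delta I)"
  using delta_le_prob_of[OF assms] delta_pos by simp

lemma algorithm_cost:
  assumes approx: "steiner_approx \<alpha> S" and \<pi>: "adaptive_policy I \<pi>"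
    and rs: "round_start I W (set us) \<phi>"
    and t: "\<And>\<psi>. \<psi> \<in> Psi I \<phi> \<Longrightarrow> exec I S \<psi> W us \<phi> (play I \<psi> t us)"
  shows "(\<Sum>\<psi>\<in>Psi I \<phi>. p \<psi> * sum w (set (play I \<psi> t us) - set us)) \<le>
    (\<Sum>\<psi>\<in>Psi I \<phi>. p \<psi> * (2 * \<alpha> * (1 + log 2 (prob_of I \<phi> / delta I)) * excess \<pi> \<psi>))"
proof -
  have \<alpha>: "0 \<le> \<alpha>" using steiner_approx_ge_1[OF approx] by simp
  let ?lg = "\<lambda>\<phi>. log 2 (prob_of I \<phi> / delta I)"
  define cost where "cost t us \<phi> = (\<Sum>\<psi>\<in>Psi I \<phi>. p \<psi> * sum w (set (play I \<psi> t us) - set us))"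
    for t us \<phi>
  \<comment> \<open>Inside a round the rest of \<open>H_star\<close> is already charged, and
    \<open>?lg \<phi>0\<close>, without the summand 1, pays for all later rounds. The potential
    keeps its value from the start of the round because halving is measured against
    \<open>\<phi>0\<close>; \<open>round_cost\<close> adds the 1 for the current round.\<close>
  define Q where "Q W U \<phi>0 us \<phi> \<longleftrightarrow>
    (\<forall>t. (\<forall>\<psi>\<in>Psi I \<phi>. resume I S \<psi> W U \<phi>0 us \<phi> (play I \<psi> t us)) \<longrightarrow>
      cost t us \<phi> \<le> (\<Sum>\<psi>\<in>Psi I \<phi>. p \<psi> *
        (sum w (H_star I S W U \<phi>0 - set us) + 2 * \<alpha> * ?lg \<phi>0 * excess \<pi> \<psi>)))" for W U \<phi>0 us \<phi>
  have halted: "cost t us \<phi> = 0" if "\<And>\<psi>. \<psi> \<in> Psi I \<phi> \<Longrightarrow> play I \<psi> t us = us" for t us \<phi>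
    using that by (simp add: cost_def)
  from approx rs have "\<forall>t. (\<forall>\<psi>\<in>Psi I \<phi>. exec I S \<psi> W us \<phi> (play I \<psi> t us)) \<longrightarrow>
    cost t us \<phi> \<le> (\<Sum>\<psi>\<in>Psi I \<phi>. p \<psi> * (2 * \<alpha> * (1 + ?lg \<phi>) * excess \<pi> \<psi>))"
  proof (induction rule: algorithm_induct[where Q = Q])
    case (halt W us \<phi>)
    interpret round_start I W "set us" \<phi> by (rule halt)
    have "0 \<le> (\<Sum>\<psi>\<in>Psi I \<phi>. p \<psi> * (2 * \<alpha> * (1 + ?lg \<phi>) * excess \<pi> \<psi>))"
      using \<alpha> log_prob_nonneg[OF Psi_nonempty] excess_nonneg
      by (intro sum_nonneg mult_nonneg_nonneg) auto
    then show ?case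
      using halt(2) halted[of \<phi> _ us] by (auto simp: exec_iff dominated_iff)
  next
    case (round W us \<phi>)
    interpret round_start I W "set us" \<phi> by (rule round)
    let ?Hs = "H_star I S W (set us) \<phi>"
    show ?case
    proof (intro allI impI)
      fix t assume "\<forall>\<psi>\<in>Psi I \<phi>. exec I S \<psi> W us \<phi> (play I \<psi> t us)"
      then have "cost t us \<phi> \<le> (\<Sum>\<psi>\<in>Psi I \<phi>. p \<psi> *
          (sum w (?Hs - set us) + 2 * \<alpha> * ?lg \<phi> * excess \<pi> \<psi>))"
        using round(2,3) by (simp add: exec_iff[of I S _ W] dominated_iff Q_def)
      also have "\<dots> = prob_of I \<phi> * sum w (?Hs - set us) +
          (\<Sum>\<psi>\<in>Psi I \<phi>. p \<psi> * (2 * \<alpha> * ?lg \<phi> * excess \<pi> \<psi>))"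
        by (simp add: distrib_left sum.distrib prob_of_eq sum_distrib_right[symmetric])
      also have "prob_of I \<phi> * sum w (?Hs - set us) \<le> prob_of I \<phi> * sum w ?Hs"
        using prob_of_pos[OF Psi_nonempty]
        by (intro mult_left_mono sum_mono2) (auto simp: w_nonneg)
      also have "\<dots> \<le> 2 * \<alpha> * (\<Sum>\<psi>\<in>Psi I \<phi>. p \<psi> * excess \<pi> \<psi>)"
        using round_cost[OF approx \<pi>] by (simp add: excess_def)
      also have "\<dots> + (\<Sum>\<psi>\<in>Psi I \<phi>. p \<psi> * (2 * \<alpha> * ?lg \<phi> * excess \<pi> \<psi>)) =
          (\<Sum>\<psi>\<in>Psi I \<phi>. p \<psi> * (2 * \<alpha> * (1 + ?lg \<phi>) * excess \<pi> \<psi>))"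
        unfolding sum_distrib_left sum.distrib[symmetric]
        by (rule sum.cong) (auto simp: algebra_simps)
      finally show "cost t us \<phi> \<le> (\<Sum>\<psi>\<in>Psi I \<phi>. p \<psi> * (2 * \<alpha> * (1 + ?lg \<phi>) * excess \<pi> \<psi>))"
        by simp
    qed
  next
    case (finish W U \<phi>0 us \<phi>)
    interpret sweep_state I W U \<phi>0 "set us" \<phi> "H_star I S W U \<phi>0" by (rule finish)
    interpret pr: round_start I "prune I W \<phi>" "set us" \<phi> by (rule now.round_start_prune)
    let ?Hs = "H_star I S W U \<phi>0"
    have lg0: "0 \<le> ?lg \<phi>0" by (rule log_prob_nonneg[OF Psi_nonempty])
    show ?case
      unfolding Q_def
    proof (intro allI impI)
      fix t assume "\<forall>\<psi>\<in>Psi I \<phi>. resume I S \<psi> W U \<phi>0 us \<phi> (play I \<psi> t us)"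
      then have ex: "\<forall>\<psi>\<in>Psi I \<phi>. exec I S \<psi> (prune I W \<phi>) us \<phi> (play I \<psi> t us)"
        using finish(2) by (simp add: resume_finished)
      let ?B = "\<Sum>\<psi>\<in>Psi I \<phi>. p \<psi> *
        (sum w (?Hs - set us) + 2 * \<alpha> * ?lg \<phi>0 * excess \<pi> \<psi>)"
      show "cost t us \<phi> \<le> ?B"
      proof (cases "prune I W \<phi> \<subseteq> nbhs E (set us)")
        case True
        then have "cost t us \<phi> = 0"
          using ex by (intro halted) (simp add: exec_iff pr.dominated_iff)
        moreover have "0 \<le> ?B"
          using \<alpha> lg0 excess_nonneg w_nonneg
          by (intro sum_nonneg mult_nonneg_nonneg add_nonneg_nonneg) auto
        ultimately show ?thesis by simp
      next
        case False
        then have "2 * prob_of I \<phi> \<le> prob_of I \<phi>0" using finish(3) by blast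
        then have lg: "1 + ?lg \<phi> \<le> ?lg \<phi>0" by (rule log_halved[OF now.Psi_nonempty])
        have "cost t us \<phi> \<le> (\<Sum>\<psi>\<in>Psi I \<phi>. p \<psi> * (2 * \<alpha> * (1 + ?lg \<phi>) * excess \<pi> \<psi>))"
          using finish(4) ex by blast
        also have "\<dots> \<le> ?B"
        proof (intro sum_mono mult_left_mono)
          fix \<psi>
          have "2 * \<alpha> * (1 + ?lg \<phi>) * excess \<pi> \<psi> \<le> 2 * \<alpha> * ?lg \<phi>0 * excess \<pi> \<psi>"
            using lg \<alpha> excess_nonneg by (intro mult_right_mono mult_left_mono) auto
          moreover have "0 \<le> sum w (?Hs - set us)" by (simp add: sum_nonneg w_nonneg)
          ultimately show "2 * \<alpha> * (1 + ?lg \<phi>) * excess \<pi> \<psi> \<le>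
            sum w (?Hs - set us) + 2 * \<alpha> * ?lg \<phi>0 * excess \<pi> \<psi>" by linarith
        qed simp
        finally show ?thesis .
      qed
    qed
  next
    case (step W U \<phi>0 us \<phi>)
    interpret sweep_state I W U \<phi>0 "set us" \<phi> "H_star I S W U \<phi>0" by (rule step)
    let ?Hs = "H_star I S W U \<phi>0"
    show ?case
      unfolding Q_def
    proof (intro allI impI)
      fix t assume res: "\<forall>\<psi>\<in>Psi I \<phi>. resume I S \<psi> W U \<phi>0 us \<phi> (play I \<psi> t us)"
      obtain \<psi>0 where "\<psi>0 \<in> Psi I \<phi>" using now.Psi_nonempty by blast
      then obtain v k where t: "t = Choose v k"
        and v: "v \<in> (?Hs - set us) \<inter> nbhs (induced E W) (set us)"
        using resume_play[OF step(2)] res by blast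
      let ?us = "us @ [v]" and ?ob = "\<lambda>\<psi>. observed I \<psi> (insert v (set us))"
        and ?rev = "\<lambda>\<psi>. reveal I \<psi> W v \<phi>"
      have after: "resume_after I S \<psi> W U \<phi>0 v ?us (?rev \<psi>) (play I \<psi> (k (?ob \<psi>)) ?us)"
        if "\<psi> \<in> Psi I \<phi>" for \<psi>
        using resume_play[OF step(2) res[rule_format, OF that]] t by blast
      have Hs: "sum w (?Hs - set us) = w v + sum w (?Hs - set ?us)"
      proof -
        have "?Hs - set us = insert v (?Hs - set ?us)" using v by auto
        then show ?thesis by simp
      qed
      have new: "sum w (set (play I \<psi> t us) - set us) =
          w v + sum w (set (play I \<psi> (k (?ob \<psi>)) ?us) - set ?us)" for \<psi>
      proof -
        have "set (play I \<psi> t us) - set us =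
            insert v (set (play I \<psi> (k (?ob \<psi>)) ?us) - set ?us)"
          using v t set_play[of ?us I \<psi> "k (?ob \<psi>)"] by auto
        then show ?thesis by simp
      qed
      let ?f = "\<lambda>\<psi>. p \<psi> * sum w (set (play I \<psi> (k (?ob \<psi>)) ?us) - set ?us)"
      let ?g = "\<lambda>\<psi>. p \<psi> * (sum w (?Hs - set ?us) + 2 * \<alpha> * ?lg \<phi>0 * excess \<pi> \<psi>)"
      \<comment> \<open>On a class with equal \<open>reveal\<close> the subtree is the same, and so
        is the decision whether the round goes on; the induction hypotheses apply to each
        class.\<close>
      have "sum ?f (Psi I \<phi>) \<le> sum ?g (Psi I \<phi>)"
      proof (rule sum_mono_fibers[where h = ?rev])
        fix \<psi> assume \<psi>: "\<psi> \<in> Psi I \<phi>"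
        have fib: "{\<psi>' \<in> Psi I \<phi>. ?rev \<psi>' = ?rev \<psi>} = Psi I (?rev \<psi>)"
          using Psi_reveal[OF \<psi>] by blast
        have same: "\<psi>' \<in> Psi I \<phi>" "?rev \<psi>' = ?rev \<psi>" "?ob \<psi>' = ?ob \<psi>"
          if "\<psi>' \<in> Psi I (?rev \<psi>)" for \<psi>'
        proof -
          show *: "\<psi>' \<in> Psi I \<phi>" "?rev \<psi>' = ?rev \<psi>" using that fib by blast+
          then show "?ob \<psi>' = ?ob \<psi>" using observed_next_iff[OF v \<psi>] by blast
        qed
        have f: "sum ?f (Psi I (?rev \<psi>)) = cost (k (?ob \<psi>)) ?us (?rev \<psi>)"
          unfolding cost_def by (rule sum.cong) (auto simp: same(3))
        have af: "resume_after I S \<psi>' W U \<phi>0 v ?us (?rev \<psi>) (play I \<psi>' (k (?ob \<psi>)) ?us)"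
          if "\<psi>' \<in> Psi I (?rev \<psi>)" for \<psi>'
          using after[OF same(1)[OF that]] same(2,3)[OF that] by simp
        have "cost (k (?ob \<psi>)) ?us (?rev \<psi>) \<le> sum ?g (Psi I (?rev \<psi>))"
        proof (cases "matches I W U \<phi>0 v (?rev \<psi>)")
          case True
          then show ?thesis
            using step(3)[OF v \<psi> True] af unfolding Q_def by (simp add: resume_after_def)
        next
          case False
          have ne: "Psi I (?rev \<psi>) \<noteq> {}" using in_Psi_reveal[OF \<psi>] by blast
          have half: "2 * prob_of I (?rev \<psi>) \<le> prob_of I \<phi>0" using step(4)[OF v \<psi> False] by blast
          have lg: "1 + ?lg (?rev \<psi>) \<le> ?lg \<phi>0" by (rule log_halved[OF ne half])
          have "cost (k (?ob \<psi>)) ?us (?rev \<psi>) \<le> (\<Sum>\<psi>'\<in>Psi I (?rev \<psi>).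
              p \<psi>' * (2 * \<alpha> * (1 + ?lg (?rev \<psi>)) * excess \<pi> \<psi>'))"
            using step(4)[OF v \<psi> False] af False by (simp add: resume_after_def)
          also have "\<dots> \<le> sum ?g (Psi I (?rev \<psi>))"
          proof (intro sum_mono mult_left_mono)
            fix \<psi>'
            have "2 * \<alpha> * (1 + ?lg (?rev \<psi>)) * excess \<pi> \<psi>' \<le> 2 * \<alpha> * ?lg \<phi>0 * excess \<pi> \<psi>'"
              using lg \<alpha> excess_nonneg by (intro mult_right_mono mult_left_mono) auto
            moreover have "0 \<le> sum w (?Hs - set ?us)" by (simp add: sum_nonneg w_nonneg)
            ultimately show "2 * \<alpha> * (1 + ?lg (?rev \<psi>)) * excess \<pi> \<psi>' \<le>
              sum w (?Hs - set ?us) + 2 * \<alpha> * ?lg \<phi>0 * excess \<pi> \<psi>'" by linarith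
          qed simp
          finally show ?thesis .
        qed
        then show "sum ?f {\<psi>' \<in> Psi I \<phi>. ?rev \<psi>' = ?rev \<psi>} \<le>
            sum ?g {\<psi>' \<in> Psi I \<phi>. ?rev \<psi>' = ?rev \<psi>}"
          unfolding fib f .
      qed simp
      then show "cost t us \<phi> \<le> (\<Sum>\<psi>\<in>Psi I \<phi>. p \<psi> *
        (sum w (?Hs - set us) + 2 * \<alpha> * ?lg \<phi>0 * excess \<pi> \<psi>))"
        unfolding cost_def new Hs by (simp add: distrib_left sum.distrib)
    qed
  qed
  then show ?thesis using t unfolding cost_def by blast
qed

text \<open>The initial graph is a function of the initial observation, so realizations with the
  same observation start in the same state.\<close>

lemma initial_graph:
  assumes "\<psi> r"
  shows "UNIV - {v \<in> nbh E r. \<not> \<psi> v} = {v. observed I \<psi> {r} v \<noteq> Some False}"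
  using assms by (auto simp: observed_def active_def nbhs_def nbh_def)

lemma Psi_initial:
  assumes "\<psi> \<in> set_pmf (dist I)"
  shows "Psi I (observed I \<psi> {r}) =
    {\<psi>' \<in> set_pmf (dist I). observed I \<psi>' {r} = observed I \<psi> {r}}"
proof -
  have ob: "observed I \<psi> {r} = (\<lambda>u. if u \<in> nbh E r then Some (\<psi> u) else None)"
    if "\<psi> \<in> set_pmf (dist I)" for \<psi>
    using support_full[OF that]
    by (auto simp: full_realizations_def observed_def active_def nbhs_def nbh_def)
  have "extends \<psi>' (observed I \<psi> {r}) \<longleftrightarrow> observed I \<psi>' {r} = observed I \<psi> {r}"
    if "\<psi>' \<in> set_pmf (dist I)" for \<psi>'
    unfolding ob[OF assms] ob[OF that] extends_def fun_eq_iff dom_def by auto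
  then show ?thesis by (auto simp: Psi_iff)
qed

lemma round_start_initial:
  assumes "\<psi> \<in> set_pmf (dist I)"
  shows "round_start I (UNIV - {v \<in> nbh E r. \<not> \<psi> v}) (set [r]) (observed I \<psi> {r})"
proof -
  have r: "\<psi> r" using support_full[OF assms] by (simp add: full_realizations_def)
  have ob: "observed I \<psi> {r} = (\<lambda>u. if u \<in> nbh E r then Some (\<psi> u) else None)"
    using r by (auto simp: observed_def active_def nbhs_def nbh_def)
  show ?thesis
  proof unfold_locales
    show "Psi I (observed I \<psi> {r}) \<noteq> {}" using Psi_initial[OF assms] assms by blast
    fix \<psi>' x u
    assume "\<psi>' \<in> Psi I (observed I \<psi> {r})" "u \<notin> UNIV - {v \<in> nbh E r. \<not> \<psi> v}"
    then show "\<not> \<psi>' u" using Psi_state[of \<psi>' "observed I \<psi> {r}" u False] by (simp add: ob)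
  qed (use r in \<open>auto simp: ob nbhs_def component_refl nbh_def split: if_splits\<close>)
qed

end

theorem theorem4:
  fixes I :: "('v::finite) rcds" and S :: "'v steiner_alg" and \<alpha> :: real
  assumes "robust_cds I"
    and "steiner_approx \<alpha> S"
  shows "(\<exists>\<pi>. algorithm_policy I S \<pi>) \<and>
    (\<forall>\<pi>. algorithm_policy I S \<pi> \<longrightarrow>
      adaptive_policy I \<pi> \<and>
      (\<forall>\<pi>'. adaptive_policy I \<pi>' \<longrightarrow>
        w_avg I \<pi> \<le> 2 * \<alpha> * (1 + log 2 (1 / delta I)) * w_avg I \<pi>'))"
proof -
  interpret rcds_instance I by unfold_locales (rule assms(1))
  let ?ob = "\<lambda>\<psi>. observed I \<psi> {r}"
  let ?W = "\<lambda>\<psi>. UNIV - {v \<in> nbh E r. \<not> \<psi> v}"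
  have W_cong: "?W \<psi>' = ?W \<psi>" if "\<psi> \<in> set_pmf (dist I)" "\<psi>' \<in> Psi I (?ob \<psi>)" for \<psi> \<psi>'
  proof -
    have "?ob \<psi>' = ?ob \<psi>" using that Psi_initial by blast
    then show ?thesis
      using initial_graph root_active[OF that(2)] support_full[OF that(1)]
      by (simp add: full_realizations_def)
  qed
  have exists: "\<exists>\<pi>. algorithm_policy I S \<pi>"
  proof -
    have "\<forall>\<psi>\<in>set_pmf (dist I). \<exists>t. \<forall>\<psi>'\<in>Psi I (?ob \<psi>).
        exec I S \<psi>' (?W \<psi>) [r] (?ob \<psi>) (play I \<psi>' t [r])"
      using tree_algorithm[OF assms(2) round_start_initial] by blast
    from bchoice[OF this] obtain F where F: "\<And>\<psi> \<psi>'. \<psi> \<in> set_pmf (dist I) \<Longrightarrow>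
        \<psi>' \<in> Psi I (?ob \<psi>) \<Longrightarrow> exec I S \<psi>' (?W \<psi>) [r] (?ob \<psi>) (play I \<psi>' (F \<psi>) [r])"
      by blast
    define \<pi> where "\<pi> ob = F (SOME \<psi>. \<psi> \<in> set_pmf (dist I) \<and> ?ob \<psi> = ob)" for ob
    have "algorithm_output I S \<psi>' (run I \<pi> \<psi>')" if \<psi>': "\<psi>' \<in> set_pmf (dist I)" for \<psi>'
    proof -
      define \<psi> where "\<psi> = (SOME \<psi>. \<psi> \<in> set_pmf (dist I) \<and> ?ob \<psi> = ?ob \<psi>')"
      have \<psi>: "\<psi> \<in> set_pmf (dist I) \<and> ?ob \<psi> = ?ob \<psi>'"
        unfolding \<psi>_def by (rule someI[of _ \<psi>']) (use \<psi>' in auto)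
      then have in_Psi: "\<psi>' \<in> Psi I (?ob \<psi>)" using Psi_initial \<psi>' by auto
      have "\<pi> (?ob \<psi>') = F \<psi>" by (simp add: \<pi>_def \<psi>_def)
      then show ?thesis
        using F[of \<psi> \<psi>'] \<psi> in_Psi W_cong[of \<psi> \<psi>'] by (simp add: algorithm_output_def run_def)
    qed
    then show ?thesis unfolding algorithm_policy_def by blast
  qed
  have "adaptive_policy I \<pi> \<and> (\<forall>\<pi>'. adaptive_policy I \<pi>' \<longrightarrow>
      w_avg I \<pi> \<le> 2 * \<alpha> * (1 + log 2 (1 / delta I)) * w_avg I \<pi>')"
    if \<pi>: "algorithm_policy I S \<pi>" for \<pi>
  proof (intro conjI allI impI)
    have out: "exec I S \<psi> (?W \<psi>) [r] (?ob \<psi>) (play I \<psi> (\<pi> (?ob \<psi>)) [r])"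
      if "\<psi> \<in> set_pmf (dist I)" for \<psi>
      using \<pi> that by (simp add: algorithm_policy_def algorithm_output_def run_def)
    show "adaptive_policy I \<pi>"
      unfolding adaptive_policy_def
    proof
      fix \<psi> assume \<psi>: "\<psi> \<in> set_pmf (dist I)"
      then have "\<psi> \<in> Psi I (?ob \<psi>)" using Psi_initial by blast
      then show "legal I \<psi> (\<pi> (?ob \<psi>)) [r]"
        by (rule legal_algorithm[OF assms(2) round_start_initial[OF \<psi>] _ out[OF \<psi>]])
    qed
    fix \<pi>' assume \<pi>': "adaptive_policy I \<pi>'"
    define K where "K = 2 * \<alpha> * (1 + log 2 (1 / delta I))"
    have \<alpha>: "1 \<le> \<alpha>" by (rule steiner_approx_ge_1[OF assms(2)])
    have dl: "0 < delta I" "delta I \<le> 1"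
    proof -
      obtain \<psi> where "\<psi> \<in> set_pmf (dist I)" using set_pmf_not_empty[of "dist I"] by blast
      then have "delta I \<le> p \<psi>" by (intro delta_le) (simp add: pmf_positive)
      then show "delta I \<le> 1" using pmf_le_1[of "dist I" \<psi>] by linarith
    qed (rule delta_pos)
    have lg: "0 \<le> log 2 (1 / delta I)" using dl by simp
    \<comment> \<open>Through \<open>w r \<le> K * w r\<close> this absorbs the algorithm's own
      payment for the root.\<close>
    have K: "1 \<le> K"
      unfolding K_def using \<alpha> lg mult_mono[of 1 "2 * \<alpha>" 1 "1 + log 2 (1 / delta I)"] by simp
    have avg: "w_avg I \<rho> = (\<Sum>\<psi>\<in>set_pmf (dist I). p \<psi> * policy_weight I \<rho> \<psi>)" for \<rho>
      unfolding w_avg_def using support_full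
      by (intro sum.mono_neutral_right) (auto simp: set_pmf_iff)
    have "(\<Sum>\<psi>\<in>set_pmf (dist I). p \<psi> * policy_weight I \<pi> \<psi>) \<le>
        (\<Sum>\<psi>\<in>set_pmf (dist I). p \<psi> * (K * policy_weight I \<pi>' \<psi>))"
    proof (rule sum_mono_fibers[where h = ?ob])
      fix \<psi> assume \<psi>: "\<psi> \<in> set_pmf (dist I)"
      have fib: "{\<psi>' \<in> set_pmf (dist I). ?ob \<psi>' = ?ob \<psi>} = Psi I (?ob \<psi>)"
        using Psi_initial[OF \<psi>] by blast
      let ?t = "\<pi> (?ob \<psi>)" and ?L = "1 + log 2 (prob_of I (?ob \<psi>) / delta I)"
      have run: "run I \<pi> \<psi>' = play I \<psi>' ?t [r]" if "\<psi>' \<in> Psi I (?ob \<psi>)" for \<psi>'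
        using that fib[symmetric] by (simp add: run_def)
      have ex: "exec I S \<psi>' (?W \<psi>) [r] (?ob \<psi>) (play I \<psi>' ?t [r])"
        if \<psi>': "\<psi>' \<in> Psi I (?ob \<psi>)" for \<psi>'
      proof -
        have "\<psi>' \<in> set_pmf (dist I)" "?ob \<psi>' = ?ob \<psi>" using \<psi>' fib by blast+
        with out[of \<psi>'] W_cong[OF \<psi> \<psi>'] show ?thesis by simp
      qed
      have weight: "policy_weight I \<pi> \<psi>' = w r + sum w (set (play I \<psi>' ?t [r]) - set [r])"
        if "\<psi>' \<in> Psi I (?ob \<psi>)" for \<psi>'
      proof -
        have "r \<in> set (run I \<pi> \<psi>')" using set_play[of "[r]"] by (simp add: run_def)
        then show ?thesis by (simp add: policy_weight_def run[OF that] sum_diff1)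
      qed
      have ne: "Psi I (?ob \<psi>) \<noteq> {}" using Psi_initial[OF \<psi>] \<psi> by blast
      have L: "2 * \<alpha> * ?L \<le> K"
        unfolding K_def using \<alpha> dl prob_of_pos[OF ne] prob_of_le_1[of "?ob \<psi>"]
        by (intro mult_left_mono add_left_mono) (auto simp: divide_right_mono)
      have "(\<Sum>\<psi>'\<in>Psi I (?ob \<psi>). p \<psi>' * policy_weight I \<pi> \<psi>') =
          (\<Sum>\<psi>'\<in>Psi I (?ob \<psi>). p \<psi>' * w r) +
          (\<Sum>\<psi>'\<in>Psi I (?ob \<psi>). p \<psi>' * sum w (set (play I \<psi>' ?t [r]) - set [r]))"
        unfolding sum.distrib[symmetric] by (rule sum.cong) (auto simp: weight distrib_left)
      also have "\<dots> \<le> (\<Sum>\<psi>'\<in>Psi I (?ob \<psi>). p \<psi>' * w r) +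
          (\<Sum>\<psi>'\<in>Psi I (?ob \<psi>). p \<psi>' * (2 * \<alpha> * ?L * excess \<pi>' \<psi>'))"
        using algorithm_cost[OF assms(2) \<pi>' round_start_initial[OF \<psi>] ex] by simp
      also have "\<dots> = (\<Sum>\<psi>'\<in>Psi I (?ob \<psi>). p \<psi>' * (w r + 2 * \<alpha> * ?L * excess \<pi>' \<psi>'))"
        by (simp add: distrib_left sum.distrib)
      also have "\<dots> \<le> (\<Sum>\<psi>'\<in>Psi I (?ob \<psi>). p \<psi>' * (K * policy_weight I \<pi>' \<psi>'))"
      proof (intro sum_mono mult_left_mono)
        fix \<psi>'
        have "w r + 2 * \<alpha> * ?L * excess \<pi>' \<psi>' \<le> K * w r + K * excess \<pi>' \<psi>'"
          using K L w_nonneg[of r] excess_nonneg[of \<pi>' \<psi>']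
          by (intro add_mono mult_right_mono) (auto simp: mult_le_cancel_right1)
        also have "\<dots> = K * policy_weight I \<pi>' \<psi>'" by (simp add: excess_def algebra_simps)
        finally show "w r + 2 * \<alpha> * ?L * excess \<pi>' \<psi>' \<le> K * policy_weight I \<pi>' \<psi>'" .
      qed simp
      finally show "(\<Sum>\<psi>' | \<psi>' \<in> set_pmf (dist I) \<and> ?ob \<psi>' = ?ob \<psi>. p \<psi>' * policy_weight I \<pi> \<psi>') \<le>
          (\<Sum>\<psi>' | \<psi>' \<in> set_pmf (dist I) \<and> ?ob \<psi>' = ?ob \<psi>. p \<psi>' * (K * policy_weight I \<pi>' \<psi>'))"
        unfolding fib .
    qed simp
    also have "\<dots> = K * (\<Sum>\<psi>\<in>set_pmf (dist I). p \<psi> * policy_weight I \<pi>' \<psi>)"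
      unfolding sum_distrib_left by (rule sum.cong) auto
    finally show "w_avg I \<pi> \<le> 2 * \<alpha> * (1 + log 2 (1 / delta I)) * w_avg I \<pi>'"
      unfolding avg K_def .
  qed
  with exists show ?thesis by blast
qed

end
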